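(* Let $\mathbf{T}=(T_t\colon t\ge 0)$ be a subordinator with the Laplace exponent $\phi$. Suppose that $-\phi''\in\mathrm{WLSC}(\alpha-2,c,x_0)$ for some $c\in(0,1]$, $x_0\ge 0$, and $\alpha>0$. Then the probability distribution of $T_t$ is absolutely continuous for all $t>0$. If its density is denoted by $p(t,\cdot)$, then for each $\epsilon>0$ there is $M_0>0$ such that $$\Big|\,p\big(t,t\phi'(w)\big)\sqrt{2\pi t(-\phi''(w))}\,\exp\big\{t\big(\phi(w)-w\phi'(w)\big)\big\}-1\Big|\le\epsilon,$$ provided that $w>x_0$ and $t w^2(-\phi''(w))>M_0$.
   Context: A subordinator is a one-dimensional Lévy process $\mathbf{T}=(T_t\colon t\ge 0)$ with $T_0=0$ and nondecreasing paths. Its Laplace exponent $\phi\colon[0,\infty)\to[0,\infty)$ is defined by $\mathbb{E}\,e^{-\lambda T_t}=e^{-t\phi(\lambda)}$, and $\phi(\lambda)=b\lambda+\int_{(0,\infty)}(1-e^{-\lambda s})\,\nu(\mathrm{d}s)$, where $b\ge 0$ and $\nu$ (the Lévy measure) satisfies $\int_{(0,\infty)}\min\{1,s\}\,\nu(\mathrm{d}s)<\infty$. It is assumed that $\phi''\not\equiv 0$. $p(t,\cdot)$ denotes the continuous version of the density. For $\tau\in\mathbb{R}$, $c\in(0,1]$, $x_0\ge 0$, a nonnegative function $f$ on $(0,\infty)$ belongs to $\mathrm{WLSC}(\tau,c,x_0)$ if $f(\lambda x)\ge c\lambda^{\tau}f(x)$ for all $\lambda\ge 1$ and $x>x_0$.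 *)

theory Defs
  imports "HOL-Probability.Probability"
begin

text \<open>Only the values \<open>T t\<close> with \<open>t \<ge> 0\<close> are constrained. Path properties are required
  almost surely.\<close>

locale levy_process = prob_space M for M :: "'a measure" +
  fixes T :: "real \<Rightarrow> 'a \<Rightarrow> real"
  assumes random_variable_T: "\<And>t. t \<ge> 0 \<Longrightarrow> random_variable borel (T t)"
    and start_zero: "AE \<omega> in M. T 0 \<omega> = 0"
    and indep_increments:
      "\<And>(n::nat) (\<tau>::nat \<Rightarrow> real). 0 \<le> \<tau> 0 \<Longrightarrow> (\<And>i. i < n \<Longrightarrow> \<tau> i < \<tau> (Suc i)) \<Longrightarrow>
         indep_vars (\<lambda>_. borel) (\<lambda>i \<omega>. T (\<tau> (Suc i)) \<omega> - T (\<tau> i) \<omega>) {..<n}"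
    and stationary_increments:
      "\<And>s t. s \<ge> 0 \<Longrightarrow> t \<ge> 0 \<Longrightarrow>
         distr M borel (\<lambda>\<omega>. T (s + t) \<omega> - T s \<omega>) = distr M borel (T t)"
    and stochastically_continuous:
      "\<And>s \<delta>. s \<ge> 0 \<Longrightarrow> \<delta> > 0 \<Longrightarrow>
         ((\<lambda>t. prob {\<omega> \<in> space M. \<bar>T t \<omega> - T s \<omega>\<bar> > \<delta>}) \<longlongrightarrow> 0) (at s within {0..})"
    and cadlag_paths:
      "AE \<omega> in M. (\<forall>t\<ge>0. continuous (at_right t) (\<lambda>s. T s \<omega>)) \<and>
                  (\<forall>t>0. \<exists>l. ((\<lambda>s. T s \<omega>) \<longlongrightarrow> l) (at_left t))"

locale subordinator = levy_process +
  assumes nondecreasing_paths: "AE \<omega> in M. mono_on {0..} (\<lambda>t. T t \<omega>)"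

text \<open>The Laplace exponent lives on \<open>[0,\<infinity>)\<close>; the values of \<open>\<phi>\<close> at negative arguments are
  irrelevant, and its derivatives are only ever taken at interior points of \<open>[0,\<infinity>)\<close>.\<close>

definition laplace_exponent ::
    "'a measure \<Rightarrow> (real \<Rightarrow> 'a \<Rightarrow> real) \<Rightarrow> (real \<Rightarrow> real) \<Rightarrow> bool" where
  "laplace_exponent M T \<phi> \<longleftrightarrow>
     (\<forall>t\<ge>0. \<forall>u\<ge>0. (LINT \<omega>|M. exp (- u * T t \<omega>)) = exp (- t * \<phi> u))"

text \<open>A measure on \<open>(0,\<infinity>)\<close> is represented by a Borel measure on the real line that does not
  charge \<open>(-\<infinity>,0]\<close>. Such a measure need not be finite, not even on bounded sets.\<close>

definition subordinator_levy_measure :: "real measure \<Rightarrow> bool" where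
  "subordinator_levy_measure \<nu> \<longleftrightarrow>
     sets \<nu> = sets borel \<and> emeasure \<nu> {..0} = 0 \<and>
     (\<integral>\<^sup>+ s\<in>{0<..}. ennreal (min 1 s) \<partial>\<nu>) < \<infinity>"

definition levy_khintchine :: "real \<Rightarrow> real measure \<Rightarrow> (real \<Rightarrow> real) \<Rightarrow> bool" where
  "levy_khintchine b \<nu> \<phi> \<longleftrightarrow>
     b \<ge> 0 \<and> subordinator_levy_measure \<nu> \<and>
     (\<forall>u\<ge>0. \<phi> u = b * u + (LINT s:{0<..}|\<nu>. 1 - exp (- u * s)))"

definition WLSC :: "real \<Rightarrow> real \<Rightarrow> real \<Rightarrow> (real \<Rightarrow> real) set" where
  "WLSC \<tau> c x\<^sub>0 =
     {f. (\<forall>x>0. f x \<ge> 0) \<and> (\<forall>u\<ge>1. \<forall>x>x\<^sub>0. f (u * x) \<ge> c * u powr \<tau> * f x)}"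

text \<open>The density that is continuous on the whole real line; it is unique if it exists.\<close>

definition continuous_density :: "'a measure \<Rightarrow> ('a \<Rightarrow> real) \<Rightarrow> (real \<Rightarrow> real) \<Rightarrow> bool" where
  "continuous_density M X f \<longleftrightarrow>
     continuous_on UNIV f \<and> (\<forall>x. f x \<ge> 0) \<and> distributed M lborel X (\<lambda>x. ennreal (f x))"

end

theory Submission
  imports Defs "HOL-Complex_Analysis.Complex_Analysis" "HOL-Real_Asymp.Real_Asymp"
begin

text \<open>
  The proof is the saddle point method, in the form of a local limit theorem for tilted laws.
  Write \<open>\<sigma> = - \<phi>''\<close>, so that \<open>\<sigma>(w)\<close> is the integral of \<open>s\<^sup>2 exp (- w s)\<close> against \<open>\<nu>\<close>, and let \<open>\<Phi>\<close> be the
  analytic extension of \<open>\<phi>\<close> to the right half-plane. Weighting the law of \<open>T t\<close> with the density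
  \<open>exp (t \<phi>(w) - w x)\<close> gives a probability measure with mean \<open>t \<phi>'(w)\<close>, variance \<open>t \<sigma>(w)\<close> and, after
  centring, characteristic function \<open>exp (t \<Psi>(w, \<xi>))\<close>, where
  \<open>\<Psi>(w, \<xi>) = \<phi>(w) - \<Phi>(w - \<i>\<xi>) - \<i>\<xi> \<phi>'(w)\<close>; this follows from the identity theorem
  (\<open>laplace_transform_extension\<close>). Fourier inversion at the mean gives
  \<open>p(t, t \<phi>'(w)) exp (t (\<phi>(w) - w \<phi>'(w))) = (1 / 2\<pi>) \<integral> exp (t \<Psi>(w, \<xi>)) d\<xi>\<close> (\<open>tilted_density\<close>).

  Substituting \<open>\<xi> = u / \<surd>(t \<sigma>(w))\<close>, it remains to show that the integral of \<open>exp (t \<Psi>(w, u / \<surd>(t \<sigma>(w))))\<close>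
  over \<open>u\<close> tends to \<open>\<surd>(2\<pi>)\<close> as \<open>m = t w\<^sup>2 \<sigma>(w)\<close> tends to infinity (\<open>saddle_point_asymptotics\<close>).

  Pointwise convergence to \<open>exp (- u\<^sup>2 / 2)\<close> holds because the cubic remainder of \<open>t \<Psi>\<close> is at most
  \<open>t \<bar>\<xi>\<bar>\<^sup>3 \<sigma>(w/2) / (3 w)\<close> (\<open>Psi_approx\<close>) and \<open>\<sigma>(w/2)\<close> is at most a multiple of \<open>\<sigma>(w)\<close> (\<open>sigma_half_le\<close>); this
  is a multiple of \<open>\<bar>u\<bar>\<^sup>3 / \<surd>m\<close>.

  An integrable majorant comes from lower scaling, which forces the jumps of size at most \<open>1/R\<close> to carry
  a fixed proportion of \<open>\<sigma>(R)\<close>, whence \<open>- Re \<Psi>(w, \<xi>) \<ge> C \<xi>\<^sup>2 \<sigma>(max \<bar>\<xi>\<bar> w)\<close> (\<open>real_part_ge\<close>). Scaling once more,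
  this is at least a constant times \<open>u\<^sup>2 / t\<close> for \<open>\<bar>\<xi>\<bar> \<le> w\<close> and \<open>\<bar>u\<bar>\<^sup>\<alpha> / t\<close> for \<open>\<bar>\<xi>\<bar> \<ge> w\<close>, provided that \<open>m \<ge> 1\<close>
  and \<open>\<alpha> \<le> 2\<close> (\<open>rescaled_exp_Psi_le\<close>). For fixed \<open>t\<close> and \<open>w\<close> the same bound makes the characteristic
  function integrable, which yields the continuous density in the first place.
\<close>

section \<open>Integrals depending on a parameter, and continuous densities\<close>

text \<open>The type \<open>'b\<close> allows for both a real and a complex parameter.\<close>

lemma has_field_derivative_integral:
  fixes f f' :: "'b \<Rightarrow> 'a \<Rightarrow> 'b::{real_normed_field, banach, second_countable_topology}"
  assumes S: "open S" "convex S" "z0 \<in> S"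
    and int: "\<And>z. z \<in> S \<Longrightarrow> integrable N (f z)"
    and meas: "f' z0 \<in> borel_measurable N"
    and deriv: "AE x in N. \<forall>z\<in>S. ((\<lambda>z. f z x) has_field_derivative f' z x) (at z) \<and> norm (f' z x) \<le> h x"
    and h: "integrable N h"
  shows "((\<lambda>z. \<integral>x. f z x \<partial>N) has_field_derivative (\<integral>x. f' z0 x \<partial>N)) (at z0)"
proof -
  have "((\<lambda>z. ((\<integral>x. f z x \<partial>N) - (\<integral>x. f z0 x \<partial>N)) / (z - z0)) \<longlongrightarrow> (\<integral>x. f' z0 x \<partial>N)) (at z0 within S)"
    unfolding tendsto_at_iff_sequentially
  proof (intro allI impI)
    fix X :: "nat \<Rightarrow> 'b"
    assume X: "\<forall>i. X i \<in> S - {z0}" and lim: "X \<longlonglongrightarrow> z0"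
    have XS: "X i \<in> S" "X i \<noteq> z0" for i using X by auto
    have "(\<lambda>i. \<integral>x. (f (X i) x - f z0 x) / (X i - z0) \<partial>N) \<longlonglongrightarrow> (\<integral>x. f' z0 x \<partial>N)"
    proof (rule integral_dominated_convergence[where w = h])
      show "f' z0 \<in> borel_measurable N" "integrable N h" by fact+
      show "(\<lambda>x. (f (X i) x - f z0 x) / (X i - z0)) \<in> borel_measurable N" for i
        using int[OF XS(1)[of i]] int[OF S(3)] by measurable
      show "AE x in N. (\<lambda>i. (f (X i) x - f z0 x) / (X i - z0)) \<longlonglongrightarrow> f' z0 x"
        using deriv
      proof eventually_elim
        case (elim x)
        then have "((\<lambda>z. f z x) has_field_derivative f' z0 x) (at z0 within S)"
          using S(3) has_field_derivative_at_within by blast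
        then have "((\<lambda>z. (f z x - f z0 x) / (z - z0)) \<longlongrightarrow> f' z0 x) (at z0 within S)"
          by (simp add: has_field_derivative_iff)
        then show ?case
          unfolding tendsto_at_iff_sequentially using X lim by (auto simp: o_def)
      qed
      show "AE x in N. norm ((f (X i) x - f z0 x) / (X i - z0)) \<le> h x" for i
        using deriv
      proof eventually_elim
        case (elim x)
        have "norm (f (X i) x - f z0 x) \<le> h x * norm (X i - z0)"
          by (rule field_differentiable_bound[OF S(2), where f' = "\<lambda>z. f' z x"])
             (use elim S(3) XS in \<open>auto intro: has_field_derivative_at_within\<close>)
        then show ?case
          using XS[of i] by (simp add: norm_divide divide_le_eq)
      qed
    qed
    moreover have eq: "(\<integral>x. (f (X i) x - f z0 x) / (X i - z0) \<partial>N) =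
        ((\<integral>x. f (X i) x \<partial>N) - (\<integral>x. f z0 x \<partial>N)) / (X i - z0)" for i
      using int[OF XS(1)[of i]] int[OF S(3)] XS[of i]
      by (simp add: integral_divide_zero Bochner_Integration.integral_diff)
    ultimately show "((\<lambda>z. ((\<integral>x. f z x \<partial>N) - (\<integral>x. f z0 x \<partial>N)) / (z - z0)) \<circ> X) \<longlonglongrightarrow> (\<integral>x. f' z0 x \<partial>N)"
      unfolding eq o_def by -
  qed
  then show ?thesis
    using at_within_open[OF S(3) S(1)] by (simp add: has_field_derivative_iff)
qed

lemma continuous_nonneg_density_unique:
  fixes f g :: "real \<Rightarrow> real"
  assumes f: "continuous_on UNIV f" "\<And>x. 0 \<le> f x"
    and g: "continuous_on UNIV g" "\<And>x. 0 \<le> g x"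
    and eq: "density lborel (\<lambda>x. ennreal (f x)) = density lborel (\<lambda>x. ennreal (g x))"
  shows "f = g"
proof -
  have [measurable]: "f \<in> borel_measurable borel" "g \<in> borel_measurable borel"
    using f g by (auto intro: borel_measurable_continuous_onI)
  have "AE x in lborel. ennreal (f x) = ennreal (g x)"
    using eq by (intro sigma_finite_measure.density_unique[OF lborel.sigma_finite_measure_axioms]) auto
  then have "AE x in lborel. f x = g x"
    by eventually_elim (use f g in auto)
  moreover have "{x\<in>space lborel. f x \<noteq> g x} \<in> sets lborel" by measurable
  ultimately have "{x. f x \<noteq> g x} \<in> null_sets lborel"
    by (simp add: AE_iff_null)
  then have "negligible {x. f x \<noteq> g x}"
    by (simp add: negligible_iff_null_sets null_sets_completionI)
  moreover have "open {x. f x \<noteq> g x}"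
    using f g by (intro open_Collect_neq)
  ultimately have "{x. f x \<noteq> g x} = {}"
    using open_not_negligible by blast
  then show ?thesis by auto
qed

section \<open>Fourier inversion\<close>

text \<open>
  Levy's inversion formula gives the mass of an interval with atomless end points as a principal
  value. When the characteristic function is integrable, this is an absolutely convergent integral
  that is differentiable in the right end point, so the distribution function has the continuous
  derivative \<open>f\<close>.
\<close>
lemma (in real_distribution) integrable_char_imp_continuous_density:
  assumes int: "integrable lborel (char M)"
  defines "f \<equiv> \<lambda>x. 1 / (2 * pi) * (\<integral>\<xi>. Re (iexp (- (\<xi> * x)) * char M \<xi>) \<partial>lborel)"
  shows "continuous_on UNIV f" "\<And>x. 0 \<le> f x" "M = density lborel (\<lambda>x. ennreal (f x))"
proof -
  have [measurable]: "char M \<in> borel_measurable borel" by (rule char_measurable)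
  have bound: "\<bar>Re (iexp (- (\<xi> * x)) * char M \<xi>)\<bar> \<le> norm (char M \<xi>)" for \<xi> x
    using abs_Re_le_cmod[of "iexp (- (\<xi> * x)) * char M \<xi>"] by (simp add: norm_mult)
  have "isCont f x" for x
    unfolding continuous_at_sequentially f_def o_def
  proof (intro allI impI tendsto_intros)
    fix X :: "nat \<Rightarrow> real" assume X: "X \<longlonglongrightarrow> x"
    show "(\<lambda>n. \<integral>\<xi>. Re (iexp (- (\<xi> * X n)) * char M \<xi>) \<partial>lborel) \<longlonglongrightarrow> (\<integral>\<xi>. Re (iexp (- (\<xi> * x)) * char M \<xi>) \<partial>lborel)"
    proof (rule integral_dominated_convergence[where w = "\<lambda>\<xi>. norm (char M \<xi>)"])
      show "integrable lborel (\<lambda>\<xi>. norm (char M \<xi>))" using int by simp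
      show "AE \<xi> in lborel. norm (Re (iexp (- (\<xi> * X n)) * char M \<xi>)) \<le> norm (char M \<xi>)" for n
        using bound by simp
      show "AE \<xi> in lborel. (\<lambda>n. Re (iexp (- (\<xi> * X n)) * char M \<xi>)) \<longlonglongrightarrow> Re (iexp (- (\<xi> * x)) * char M \<xi>)"
        by (intro AE_I2 tendsto_intros X)
    qed measurable
  qed
  then show cont: "continuous_on UNIV f"
    by (simp add: continuous_on_eq_continuous_at)
  have [measurable]: "f \<in> borel_measurable borel"
    using cont by (rule borel_measurable_continuous_onI)

  \<comment> \<open>The inversion formula needs end points that are not atoms; fix one such base point.\<close>
  have cnt: "countable {x. measure M {x} \<noteq> 0}" by (rule countable_support)
  obtain a where a: "measure M {a} = 0"
    using open_minus_countable[OF cnt, of "UNIV"] by auto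
  let ?k = "\<lambda>y t. (iexp (-(t * a)) - iexp (-(t * y))) / (\<i> * t) * char M t"
  \<comment> \<open>\<open>G\<close> is going to be \<open>cdf M y - cdf M a\<close>. At \<open>t = 0\<close> the kernel is \<open>0\<close> by division by zero
      instead of \<open>y - a\<close>, which only affects a null set.\<close>
  define G where "G y = 1 / (2 * pi) * (\<integral>t. Re (?k y t) \<partial>lborel)" for y
  have kbound: "norm (?k y t) \<le> \<bar>y - a\<bar> * norm (char M t)" for y t
  proof (cases "t = 0")
    case False
    have "cmod ((iexp (-(t * a)) - iexp (-(t * y))) / (\<i> * t)) \<le> \<bar>y - a\<bar>"
      using Levy_Inversion_aux2[of "-a" "-y" t] Levy_Inversion_aux2[of "-y" "-a" t] False
      by (cases "a \<le> y") (auto simp: norm_divide norm_mult norm_minus_commute)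
    then show ?thesis by (simp add: norm_mult mult_right_mono del: times_divide_eq_left times_divide_eq_right)
  qed auto
  have kint: "integrable lborel (?k y)" for y
    by (rule Bochner_Integration.integrable_bound[where f = "\<lambda>t. \<bar>y - a\<bar> * norm (char M t)"])
       (use int kbound in \<open>auto\<close>)
  have G: "(G has_field_derivative f y) (at y)" for y
    unfolding G_def f_def
  proof (rule DERIV_cmult, rule has_field_derivative_integral[where S = UNIV and h = "\<lambda>t. norm (char M t)" and f' = "\<lambda>y \<xi>. Re (iexp (- (\<xi> * y)) * char M \<xi>)"])
    show "integrable lborel (\<lambda>t. Re (?k z t))" for z using kint by simp
    have "((\<lambda>z. Re (?k z t)) has_real_derivative Re (iexp (- (t * z)) * char M t)) (at z)" if "t \<noteq> 0" for z t
    proof -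
      have "((\<lambda>z. ?k z t) has_vector_derivative (iexp (- (t * z)) * char M t)) (at z)"
        using that by (auto intro!: derivative_eq_intros has_vector_derivative_real_field simp: field_simps)
      then show ?thesis
        by (rule has_field_derivative_Re)
    qed
    then show "AE t in lborel. \<forall>z\<in>UNIV. ((\<lambda>z. Re (?k z t)) has_real_derivative Re (iexp (- (t * z)) * char M t)) (at z) \<and>
       norm (Re (iexp (- (t * z)) * char M t)) \<le> norm (char M t)"
      using AE_lborel_singleton[of 0] bound by auto
  qed (use int in auto)

  have Levy: "measure M {u<..v} = 1 / (2 * pi) * (\<integral>t. Re ((iexp (-(t * u)) - iexp (-(t * v))) / (\<i> * t) * char M t) \<partial>lborel)"
    if uv: "u \<le> v" "measure M {u} = 0" "measure M {v} = 0"
      and kint: "integrable lborel (\<lambda>t. (iexp (-(t * u)) - iexp (-(t * v))) / (\<i> * t) * char M t)" for u v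
  proof -
    let ?k = "\<lambda>t. (iexp (-(t * u)) - iexp (-(t * v))) / (\<i> * t) * char M t"
    have "(\<lambda>n::nat. \<integral>t. indicator {- real n<..<real n} t *\<^sub>R ?k t \<partial>lborel) \<longlonglongrightarrow> (\<integral>t. ?k t \<partial>lborel)"
    proof (rule integral_dominated_convergence[where w = "\<lambda>t. norm (?k t)"])
      show "AE t in lborel. (\<lambda>n. indicator {- real n<..<real n} t *\<^sub>R ?k t) \<longlonglongrightarrow> ?k t"
      proof (rule AE_I2)
        fix t :: real
        obtain N where N: "real N > \<bar>t\<bar>" using reals_Archimedean2 by blast
        have "\<forall>\<^sub>F n in sequentially. indicator {- real n<..<real n} t *\<^sub>R ?k t = ?k t"
          using eventually_ge_at_top[of N] by eventually_elim (use N in \<open>auto simp: indicator_def\<close>)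
        then show "(\<lambda>n. indicator {- real n<..<real n} t *\<^sub>R ?k t) \<longlonglongrightarrow> ?k t"
          by (rule tendsto_eventually)
      qed
      show "AE t in lborel. norm (indicator {- real n<..<real n} t *\<^sub>R ?k t) \<le> norm (?k t)" for n
        by (auto simp: indicator_def)
      show "integrable lborel (\<lambda>t. norm (?k t))" using kint by (rule integrable_norm)
    qed measurable
    then have "(\<lambda>n::nat. 1 / (2 * pi) * (CLBINT t=-real n..real n. ?k t)) \<longlonglongrightarrow> 1 / (2 * pi) * (\<integral>t. ?k t \<partial>lborel)"
      by (intro tendsto_intros) (simp add: interval_lebesgue_integral_def set_lebesgue_integral_def)
    then have "complex_of_real (measure M {u<..v}) = 1 / (2 * pi) * (\<integral>t. ?k t \<partial>lborel)"
      using Levy_Inversion[OF uv] by (intro LIMSEQ_unique) auto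
    then have "measure M {u<..v} = Re (complex_of_real (1 / (2 * pi)) * (\<integral>t. ?k t \<partial>lborel))"
      by (metis Re_complex_of_real)
    also have "\<dots> = 1 / (2 * pi) * Re (\<integral>t. ?k t \<partial>lborel)"
      by (simp only: Re_complex_of_real Im_complex_of_real times_complex.sel)
    finally show ?thesis
      using integral_Re[OF kint] by simp
  qed
  have cdfG0: "cdf M y - cdf M a = G y" if y: "measure M {y} = 0" for y
  proof (cases "a < y")
    case True
    then show ?thesis
      using Levy[OF _ a y kint] cdf_diff_eq[OF True] by (simp add: G_def)
  next
    case False
    have neg: "(iexp (-(t * y)) - iexp (-(t * a))) / (\<i> * t) * char M t = - ?k y t" for t
      by (simp only: minus_mult_left minus_divide_left minus_diff_eq)
    have "measure M {y<..a} = - G y"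
      using Levy[of y a] False y a kint[of y] unfolding neg by (simp add: G_def)
    moreover have "measure M {y<..a} = cdf M a - cdf M y"
      using False cdf_diff_eq[of y a] by (cases "y = a") auto
    ultimately show ?thesis by simp
  qed
  have Gcont: "isCont G y" for y using G DERIV_isCont by blast
  \<comment> \<open>Atoms are countable, so every \<open>y\<close> is the limit from the right of points that are not atoms;
      right-continuity of the distribution function extends the identity to all \<open>y\<close>.\<close>
  have cdfG: "cdf M y - cdf M a = G y" for y
  proof -
    have "\<exists>b. y < b \<and> b < y + 1 / Suc n \<and> measure M {b} = 0" for n :: nat
      using open_minus_countable[OF cnt, of "{y<..<y + 1 / Suc n}"] by auto
    then obtain b where b: "\<And>n::nat. y < b n" "\<And>n. b n < y + 1 / Suc n" "\<And>n. measure M {b n} = 0"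
      by metis
    have blim: "b \<longlonglongrightarrow> y"
    proof (rule tendsto_sandwich[of "\<lambda>_. y" b _ "\<lambda>n. y + 1 / real (Suc n)"])
      show "(\<lambda>n. y + 1 / real (Suc n)) \<longlonglongrightarrow> y"
        using tendsto_add[OF tendsto_const LIMSEQ_Suc[OF lim_1_over_n], of y] by simp
    qed (use b in \<open>auto intro!: always_eventually less_imp_le tendsto_const\<close>)
    have "b n \<noteq> y" for n using b(1)[of n] by simp
    then have "filterlim b (at_right y) sequentially"
      using blim b(1) by (simp add: filterlim_at)
    then have "(\<lambda>n. cdf M (b n)) \<longlonglongrightarrow> cdf M y"
      using cdf_is_right_cont[of y] by (auto simp: continuous_within intro: filterlim_compose)
    then have "(\<lambda>n. cdf M (b n) - cdf M a) \<longlonglongrightarrow> cdf M y - cdf M a"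
      by (intro tendsto_intros)
    moreover have "(\<lambda>n. G (b n)) \<longlonglongrightarrow> G y"
      using Gcont blim by (rule isCont_tendsto_compose)
    ultimately show ?thesis
      using cdfG0[OF b(3)] by (auto intro: LIMSEQ_unique)
  qed
  have cdf_eq: "cdf M = (\<lambda>y. G y + cdf M a)"
    unfolding cdfG[symmetric] by simp
  have cdf_deriv: "(cdf M has_field_derivative f y) (at y)" for y
    by (subst cdf_eq) (auto intro!: derivative_eq_intros G)
  show f_nonneg: "0 \<le> f y" for y
    using cdf_deriv[of y] cdf_nondecreasing by (intro mono_on_imp_deriv_nonneg[of UNIV "cdf M"]) (auto simp: mono_on_def)
  show "M = density lborel (\<lambda>x. ennreal (f x))"
  proof (rule measure_eqI_lessThan)
    fix x
    show "emeasure M {x<..} < \<infinity>" by (simp add: less_top[symmetric])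
    have "AE y in lborel. ennreal (f y) * indicator {x<..} y = ennreal (f y) * indicator {x..} y"
      using AE_lborel_singleton[of x] by eventually_elim (auto simp: indicator_def)
    then have "emeasure (density lborel (\<lambda>x. ennreal (f x))) {x<..} = (\<integral>\<^sup>+y. ennreal (f y) * indicator {x..} y \<partial>lborel)"
      by (simp add: emeasure_density nn_integral_cong_AE)
    also have "\<dots> = 1 - cdf M x"
      using cdf_deriv f_nonneg cdf_lim_at_top_prob by (intro nn_integral_FTC_atLeast) auto
    also have "1 - cdf M x = measure M {x<..}"
      using prob_compl[of "{..x}"] by (simp add: cdf_def Compl_atMost[symmetric] Compl_eq_Diff_UNIV)
    finally show "emeasure M {x<..} = emeasure (density lborel (\<lambda>x. ennreal (f x))) {x<..}"
      by (simp add: emeasure_eq_measure)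
  qed simp_all
qed

section \<open>Elementary estimates\<close>

lemma power_le_fact_exp:
  fixes y :: real
  assumes "0 \<le> y"
  shows "y ^ k \<le> fact k * exp y"
proof -
  have "(\<Sum>n\<in>{k}. y ^ n /\<^sub>R fact n) \<le> exp y"
    unfolding exp_def using assms by (intro sum_le_suminf summable_exp_generic) auto
  then show ?thesis by (simp add: field_simps)
qed

lemma one_minus_cos_ge:
  fixes y :: real
  assumes "\<bar>y\<bar> \<le> 1"
  shows "y\<^sup>2 / 4 \<le> 1 - cos y"
proof -
  have "\<bar>Re (iexp y - (\<Sum>k\<le>3. (\<i> * y) ^ k / fact k))\<bar> \<le> \<bar>y\<bar> ^ 4 / 24"
    using iexp_approx1[of y 3] abs_Re_le_cmod[of "iexp y - (\<Sum>k\<le>3. (\<i> * y) ^ k / fact k)"]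
    by (simp add: fact_numeral)
  also have "Re (iexp y - (\<Sum>k\<le>3. (\<i> * y) ^ k / fact k)) = cos y - (1 - y\<^sup>2 / 2)"
    by (simp add: Re_exp eval_nat_numeral power2_eq_square)
  finally have 1: "\<bar>cos y - (1 - y\<^sup>2 / 2)\<bar> \<le> \<bar>y\<bar> ^ 4 / 24" .
  have "\<bar>y\<bar> ^ 4 = y\<^sup>2 * y\<^sup>2" by (simp add: eval_nat_numeral)
  also have "\<dots> \<le> y\<^sup>2 * 1"
    using assms abs_square_le_1 by (intro mult_left_mono) auto
  finally show ?thesis using 1 zero_le_power2[of y] by linarith
qed

lemma norm_one_minus_exp_le:
  fixes z :: complex
  assumes "0 \<le> Re z"
  shows "norm (1 - exp (- z)) \<le> norm z"
proof -
  have "norm (exp (- z) - exp (-0)) \<le> 1 * norm (z - 0)"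
    by (rule field_differentiable_bound[where S = "{z. 0 \<le> Re z}" and f' = "\<lambda>z. - exp (- z)"])
       (use assms in \<open>auto intro!: derivative_eq_intros convex_halfspace_Re_ge\<close>)
  then show ?thesis by (simp add: norm_minus_commute)
qed

text \<open>
  A function bounded by \<open>1\<close> that decays like \<open>exp (- C \<bar>y\<bar>\<^sup>\<alpha>)\<close> from \<open>r\<close> on has an integrable majorant that
  depends only on \<open>C\<close>, \<open>\<alpha>\<close> and \<open>r\<close>.
\<close>

lemma stretched_exp_le:
  fixes C \<alpha> r :: real
  assumes "0 < C" "0 < \<alpha>"
  shows "\<exists>D. \<forall>y v. v \<le> 1 \<longrightarrow> (r \<le> \<bar>y\<bar> \<longrightarrow> v \<le> exp (- (C * \<bar>y\<bar> powr \<alpha>))) \<longrightarrow> v \<le> D / (1 + y\<^sup>2)"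
proof -
  have "((\<lambda>y::real. (1 + y\<^sup>2) * exp (- (C * y powr \<alpha>))) \<longlongrightarrow> 0) at_top"
    using assms by real_asymp
  then have "\<forall>\<^sub>F y in at_top. (1 + y\<^sup>2) * exp (- (C * y powr \<alpha>)) < 1"
    by (rule order_tendstoD) simp
  then have "\<forall>\<^sub>F y in at_top. (1 + y\<^sup>2) * exp (- (C * y powr \<alpha>)) < 1 \<and> r \<le> y \<and> 1 \<le> y"
    by (intro eventually_conj eventually_ge_at_top)
  then obtain Y where Y: "\<And>y. Y \<le> y \<Longrightarrow> (1 + y\<^sup>2) * exp (- (C * y powr \<alpha>)) < 1 \<and> r \<le> y \<and> 1 \<le> y"
    unfolding eventually_at_top_linorder by auto
  show ?thesis
  proof (intro exI allI impI)
    fix y v :: real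
    assume v: "v \<le> 1" "r \<le> \<bar>y\<bar> \<longrightarrow> v \<le> exp (- (C * \<bar>y\<bar> powr \<alpha>))"
    have pos: "0 < 1 + y\<^sup>2" by (simp add: add_pos_nonneg)
    show "v \<le> (1 + Y\<^sup>2) / (1 + y\<^sup>2)"
    proof (cases "Y \<le> \<bar>y\<bar>")
      case True
      then have "(1 + y\<^sup>2) * exp (- (C * \<bar>y\<bar> powr \<alpha>)) < 1" "r \<le> \<bar>y\<bar>" using Y[OF True] by auto
      then have "(1 + y\<^sup>2) * v \<le> 1"
        using mult_left_mono[OF v(2)[rule_format], of "1 + y\<^sup>2"] pos by linarith
      also have "1 \<le> 1 + Y\<^sup>2" by simp
      finally show ?thesis using pos by (simp add: field_simps)
    next
      case False
      then have "\<bar>y\<bar> \<le> \<bar>Y\<bar>" by linarith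
      then have "y\<^sup>2 \<le> Y\<^sup>2" by (simp add: abs_le_square_iff)
      then have "1 \<le> (1 + Y\<^sup>2) / (1 + y\<^sup>2)" using pos by (simp add: field_simps)
      then show ?thesis using v by linarith
    qed
  qed
qed

lemma integrable_inverse_one_plus_square: "integrable lborel (\<lambda>y::real. D / (1 + y\<^sup>2))"
proof -
  have "integrable lborel (\<lambda>y::real. inverse (1 + y\<^sup>2))"
    using integrable_inverse_1_plus_square by (simp add: set_integrable_def)
  then have "integrable lborel (\<lambda>y::real. D * inverse (1 + y\<^sup>2))"
    by (rule integrable_mult_right)
  then show ?thesis by (simp add: divide_inverse)
qed

section \<open>Laplace exponents and their analytic extension\<close>

text \<open>
  A drift \<open>b\<close>, a Levy measure \<open>\<nu>\<close> on \<open>(0,\<infinity>)\<close> and the Laplace exponent \<open>\<phi>\<close> that they determine. Since \<open>\<nu>\<close> does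
  not charge \<open>(-\<infinity>,0]\<close>, integrals over \<open>(0,\<infinity>)\<close> are written as integrals over the whole line.
\<close>

locale levy_triplet =
  fixes b :: real and \<nu> :: "real measure" and \<phi> :: "real \<Rightarrow> real"
  assumes LK: "levy_khintchine b \<nu> \<phi>"
begin

lemma sets_nu [measurable_cong, simp]: "sets \<nu> = sets borel"
  using LK by (simp add: levy_khintchine_def subordinator_levy_measure_def)

lemma AE_nu_pos: "AE s in \<nu>. 0 < s"
proof (rule AE_I)
  show "emeasure \<nu> {..0} = 0"
    using LK by (simp add: levy_khintchine_def subordinator_levy_measure_def)
qed (auto simp: not_less)

lemma integrable_min: "integrable \<nu> (\<lambda>s. min 1 s)"
proof (rule integrableI_bounded)
  have "(\<integral>\<^sup>+ s. ennreal (norm (min 1 s)) \<partial>\<nu>) = (\<integral>\<^sup>+ s\<in>{0<..}. ennreal (min 1 s) \<partial>\<nu>)"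
    using AE_nu_pos by (intro nn_integral_cong_AE) (auto elim!: eventually_mono simp: indicator_def)
  also have "\<dots> < \<infinity>"
    using LK by (simp add: levy_khintchine_def subordinator_levy_measure_def)
  finally show "(\<integral>\<^sup>+ s. ennreal (norm (min 1 s)) \<partial>\<nu>) < \<infinity>" .
qed simp

lemma integrable_moment [intro]:
  assumes "0 < a" "0 < k"
  shows "integrable \<nu> (\<lambda>s. s ^ k * exp (- (a * s)))"
proof (rule Bochner_Integration.integrable_bound)
  define C where "C = max 1 (fact k / a ^ k)"
  show "integrable \<nu> (\<lambda>s. C * min 1 s)" using integrable_min by simp
  show "AE s in \<nu>. norm (s ^ k * exp (- (a * s))) \<le> norm (C * min 1 s)"
    using AE_nu_pos
  proof eventually_elim
    case (elim s)
    have C: "1 \<le> C" "fact k / a ^ k \<le> C" by (auto simp: C_def)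
    have "s ^ k * exp (- (a * s)) \<le> C * min 1 s"
    proof (cases "s \<le> 1")
      case True
      have "s ^ k * exp (- (a * s)) \<le> s ^ 1 * 1"
        using elim True assms by (intro mult_mono power_decreasing) auto
      also have "\<dots> \<le> C * min 1 s" using C elim True by (simp add: mult_right_mono)
      finally show ?thesis .
    next
      case False
      have "(a * s) ^ k \<le> fact k * exp (a * s)" using assms elim by (intro power_le_fact_exp) auto
      then have "s ^ k * exp (- (a * s)) \<le> fact k / a ^ k"
        using assms by (simp add: exp_minus field_simps power_mult_distrib)
      also have "\<dots> \<le> C * min 1 s" using C False by simp
      finally show ?thesis .
    qed
    then show ?case using elim by simp
  qed
qed simp

text \<open>The extension of the Laplace exponent to complex arguments; it is analytic for \<open>Re z > 0\<close>.\<close>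

definition \<Phi> :: "complex \<Rightarrow> complex" where
  "\<Phi> z = of_real b * z + (\<integral>s. 1 - exp (- (z * of_real s)) \<partial>\<nu>)"

lemma integrable_one_minus_exp:
  assumes "0 \<le> Re z"
  shows "integrable \<nu> (\<lambda>s. 1 - exp (- (z * complex_of_real s)))"
proof (rule Bochner_Integration.integrable_bound)
  show "integrable \<nu> (\<lambda>s. max 2 (norm z) * min 1 s)" using integrable_min by simp
  show "AE s in \<nu>. norm (1 - exp (- (z * complex_of_real s))) \<le> norm (max 2 (norm z) * min 1 s)"
    using AE_nu_pos
  proof eventually_elim
    case (elim s)
    have 1: "norm (1 - exp (- (z * complex_of_real s))) \<le> norm z * s"
      using norm_one_minus_exp_le[of "z * s"] assms elim by (simp add: norm_mult)
    have "norm (exp (- (z * complex_of_real s))) \<le> 1"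
      using assms elim by (simp add: mult_nonneg_nonneg)
    then have 2: "norm (1 - exp (- (z * complex_of_real s))) \<le> 2"
      using norm_triangle_ineq4[of 1 "exp (- (z * complex_of_real s))"] by (simp del: norm_exp_eq_Re)
    show ?case
    proof (cases "s \<le> 1")
      case True
      have "norm z * s \<le> max 2 (norm z) * s" using elim by (intro mult_right_mono) auto
      then have "norm (1 - exp (- (z * complex_of_real s))) \<le> max 2 (norm z) * s"
        using 1 by (rule order.trans[rotated])
      moreover have "norm (max 2 (norm z) * min 1 s) = max 2 (norm z) * s"
        using True elim by (simp add: abs_of_nonneg)
      ultimately show ?thesis by (simp only:)
    next
      case False
      then show ?thesis using 2 by simp
    qed
  qed
qed measurable

lemma Phi_has_field_derivative:
  assumes "0 < Re z"
  shows "(\<Phi> has_field_derivative (of_real b + (\<integral>s. of_real s * exp (- (z * of_real s)) \<partial>\<nu>))) (at z)"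
proof -
  have "((\<lambda>z. \<integral>s. 1 - exp (- (z * complex_of_real s)) \<partial>\<nu>) has_field_derivative (\<integral>s. of_real s * exp (- (z * of_real s)) \<partial>\<nu>)) (at z)"
  proof (rule has_field_derivative_integral[where S = "{x. Re x > Re z / 2}" and h = "\<lambda>s. s ^ 1 * exp (- ((Re z / 2) * s))"
        and f' = "\<lambda>z s. of_real s * exp (- (z * of_real s))"])
    show "AE s in \<nu>. \<forall>x\<in>{x. Re x > Re z / 2}. ((\<lambda>x. 1 - exp (- (x * complex_of_real s))) has_field_derivative of_real s * exp (- (x * of_real s))) (at x) \<and>
          norm (of_real s * exp (- (x * of_real s))) \<le> s ^ 1 * exp (- ((Re z / 2) * s))"
      using AE_nu_pos
      by eventually_elim (auto intro!: derivative_eq_intros mult_mono simp: norm_mult)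
    show "integrable \<nu> (\<lambda>s. s ^ 1 * exp (- ((Re z / 2) * s)))"
      using assms by (intro integrable_moment) auto
    show "open {x. Re x > Re z / 2}" "convex {x. Re x > Re z / 2}"
      by (rule open_halfspace_Re_gt convex_halfspace_Re_gt)+
    show "integrable \<nu> (\<lambda>s. 1 - exp (- (x * complex_of_real s)))" if "x \<in> {x. Re x > Re z / 2}" for x
      using that assms by (intro integrable_one_minus_exp) auto
  qed (use assms in auto)
  then show ?thesis
    unfolding \<Phi>_def[abs_def] by (auto intro!: derivative_eq_intros)
qed

lemma exponent_eq: 
  assumes "0 \<le> u" shows "\<phi> u = b * u + (\<integral>s. 1 - exp (- (u * s)) \<partial>\<nu>)"
proof -
  have "(LINT s:{0<..}|\<nu>. 1 - exp (- (u * s))) = (\<integral>s. 1 - exp (- (u * s)) \<partial>\<nu>)"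
    unfolding set_lebesgue_integral_def
  proof (rule integral_cong_AE)
    show "AE s in \<nu>. indicator {0<..} s *\<^sub>R (1 - exp (- (u * s))) = 1 - exp (- (u * s))"
      using AE_nu_pos by eventually_elim simp
  qed auto
  then show ?thesis using LK assms by (simp add: levy_khintchine_def)
qed

lemma Phi_of_real:
  assumes "0 \<le> u"
  shows "\<Phi> (of_real u) = of_real (\<phi> u)"
proof -
  have "(\<integral>s. 1 - exp (- (complex_of_real u * s)) \<partial>\<nu>) = (\<integral>s. complex_of_real (1 - exp (- (u * s))) \<partial>\<nu>)"
    by (simp flip: exp_of_real)
  then show ?thesis
    unfolding \<Phi>_def exponent_eq[OF assms] by (simp del: of_real_diff)
qed

text \<open>The function \<open>- \<phi>''\<close> on the positive half-line, as a moment of the tilted Levy measure.\<close>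

definition \<sigma> :: "real \<Rightarrow> real" where
  "\<sigma> u = (\<integral>s. s\<^sup>2 * exp (- (u * s)) \<partial>\<nu>)"

lemma exponent_has_derivative:
  assumes "0 < u"
  shows "(\<phi> has_field_derivative (b + (\<integral>s. s * exp (- (u * s)) \<partial>\<nu>))) (at u)"
proof -
  have int: "integrable \<nu> (\<lambda>s. 1 - exp (- (x * s)))" if "0 \<le> x" for x :: real
    using integrable_Re[OF integrable_one_minus_exp[of "of_real x"]] that by (simp add: Re_exp)
  have "((\<lambda>u. \<integral>s. 1 - exp (- (u * s)) \<partial>\<nu>) has_field_derivative (\<integral>s. s * exp (- (u * s)) \<partial>\<nu>)) (at u)"
  proof (rule has_field_derivative_integral[where S = "{u/2<..}" and h = "\<lambda>s. s ^ 1 * exp (- ((u / 2) * s))"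
        and f' = "\<lambda>u s. s * exp (- (u * s))"])
    show "AE s in \<nu>. \<forall>x\<in>{u/2<..}. ((\<lambda>x. 1 - exp (- (x * s))) has_field_derivative s * exp (- (x * s))) (at x) \<and>
          norm (s * exp (- (x * s))) \<le> s ^ 1 * exp (- ((u / 2) * s))"
      using AE_nu_pos
      by eventually_elim (auto intro!: derivative_eq_intros mult_mono)
    show "integrable \<nu> (\<lambda>s. s ^ 1 * exp (- ((u / 2) * s)))"
      using assms by (intro integrable_moment) auto
  qed (use assms in \<open>auto intro!: int\<close>)
  then have "((\<lambda>u. b * u + (\<integral>s. 1 - exp (- (u * s)) \<partial>\<nu>)) has_field_derivative (b + (\<integral>s. s * exp (- (u * s)) \<partial>\<nu>))) (at u)"
    by (auto intro!: derivative_eq_intros)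
  then show ?thesis
    by (rule has_field_derivative_transform_within_open[where S = "{0<..}"]) (use assms exponent_eq in auto)
qed

lemma deriv_exponent: "0 < u \<Longrightarrow> deriv \<phi> u = b + (\<integral>s. s * exp (- (u * s)) \<partial>\<nu>)"
  by (rule DERIV_imp_deriv) (rule exponent_has_derivative)

lemma deriv2_exponent:
  assumes "0 < u"
  shows "deriv (deriv \<phi>) u = - \<sigma> u"
proof (rule DERIV_imp_deriv)
  have "((\<lambda>u. \<integral>s. s * exp (- (u * s)) \<partial>\<nu>) has_field_derivative (\<integral>s. - (s\<^sup>2 * exp (- (u * s))) \<partial>\<nu>)) (at u)"
  proof (rule has_field_derivative_integral[where S = "{u/2<..}" and h = "\<lambda>s. s\<^sup>2 * exp (- ((u / 2) * s))"
        and f' = "\<lambda>u s. - (s\<^sup>2 * exp (- (u * s)))"])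
    show "AE s in \<nu>. \<forall>x\<in>{u/2<..}. ((\<lambda>x. s * exp (- (x * s))) has_field_derivative - (s\<^sup>2 * exp (- (x * s)))) (at x) \<and>
          norm (- (s\<^sup>2 * exp (- (x * s)))) \<le> s\<^sup>2 * exp (- ((u / 2) * s))"
      using AE_nu_pos
      by eventually_elim (auto intro!: derivative_eq_intros mult_mono simp: power2_eq_square)
    show "integrable \<nu> (\<lambda>s. s * exp (- (z * s)))" if "z \<in> {u/2<..}" for z
      using integrable_moment[of z 1] that assms by simp
    show "integrable \<nu> (\<lambda>s. s\<^sup>2 * exp (- ((u / 2) * s)))"
      using assms by (intro integrable_moment) auto
  qed (use assms in auto)
  then have "((\<lambda>u. b + (\<integral>s. s * exp (- (u * s)) \<partial>\<nu>)) has_field_derivative - \<sigma> u) (at u)"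
    unfolding \<sigma>_def by (auto intro!: derivative_eq_intros)
  then show "(deriv \<phi> has_field_derivative - \<sigma> u) (at u)"
    by (rule has_field_derivative_transform_within_open[where S = "{0<..}"]) (use assms deriv_exponent in auto)
qed

lemma integrable_sigma: "0 < u \<Longrightarrow> integrable \<nu> (\<lambda>s. s\<^sup>2 * exp (- (u * s)))"
  by (rule integrable_moment) auto

lemma sigma_nonneg: "0 \<le> \<sigma> u"
  unfolding \<sigma>_def by simp

lemma sigma_antimono:
  assumes "0 < u" "u \<le> v"
  shows "\<sigma> v \<le> \<sigma> u"
  unfolding \<sigma>_def
  using assms AE_nu_pos by (intro integral_mono_AE integrable_sigma) (auto elim!: eventually_mono intro!: mult_left_mono)

lemma sigma_pos:
  assumes "0 < u" "\<sigma> u \<noteq> 0" "0 < v"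
  shows "0 < \<sigma> v"
proof (rule ccontr)
  assume "\<not> 0 < \<sigma> v"
  then have "(\<integral>s. s\<^sup>2 * exp (- (v * s)) \<partial>\<nu>) = 0"
    using sigma_nonneg[of v] unfolding \<sigma>_def by linarith
  then have "AE s in \<nu>. s\<^sup>2 * exp (- (v * s)) = 0"
    using integrable_sigma[OF \<open>0 < v\<close>] by (subst (asm) integral_nonneg_eq_0_iff_AE) auto
  then have "AE s in \<nu>. s\<^sup>2 * exp (- (u * s)) = 0"
    by eventually_elim simp
  then have "\<sigma> u = 0" unfolding \<sigma>_def by (rule integral_eq_zero_AE)
  with assms show False by simp
qed

text \<open>The left-hand side is \<open>\<phi>'''(w)\<close>; half of the exponential weight absorbs one factor \<open>s\<close>.\<close>

lemma third_moment_le: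
  assumes "0 < w"
  shows "(\<integral>s. s ^ 3 * exp (- (w * s)) \<partial>\<nu>) \<le> 2 / w * \<sigma> (w / 2)"
proof -
  have "(\<integral>s. s ^ 3 * exp (- (w * s)) \<partial>\<nu>) \<le> (\<integral>s. 2 / w * (s\<^sup>2 * exp (- ((w / 2) * s))) \<partial>\<nu>)"
  proof (rule integral_mono_AE)
    show "AE s in \<nu>. s ^ 3 * exp (- (w * s)) \<le> 2 / w * (s\<^sup>2 * exp (- ((w / 2) * s)))"
      using AE_nu_pos
    proof eventually_elim
      case (elim s)
      have "w / 2 * s \<le> exp (w / 2 * s)" using exp_ge_add_one_self[of "w / 2 * s"] by linarith
      then have "s * exp (- ((w / 2) * s)) \<le> 2 / w"
        using assms by (simp add: exp_minus field_simps)
      then have "s * exp (- ((w / 2) * s)) * (s\<^sup>2 * exp (- ((w / 2) * s))) \<le> 2 / w * (s\<^sup>2 * exp (- ((w / 2) * s)))"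
        by (rule mult_right_mono) auto
      moreover have "exp (- ((w / 2) * s)) * exp (- ((w / 2) * s)) = exp (- (w * s))"
        by (simp flip: exp_add)
      ultimately show ?case by (simp add: power3_eq_cube power2_eq_square mult_ac)
    qed
    show "integrable \<nu> (\<lambda>s. s ^ 3 * exp (- (w * s)))"
      using assms by (intro integrable_moment) auto
    show "integrable \<nu> (\<lambda>s. 2 / w * (s\<^sup>2 * exp (- ((w / 2) * s))))"
      using assms by (intro integrable_mult_right integrable_sigma) auto
  qed
  then show ?thesis by (simp add: \<sigma>_def)
qed

section \<open>Growth of the real part on vertical lines\<close>

text \<open>
  The integral below is \<open>Re (\<Phi> (w - \<i>\<xi>) - \<Phi> w)\<close>. Only jumps \<open>s \<le> 1/R\<close> with \<open>R = max \<bar>\<xi>\<bar> w\<close> are used, for which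
  \<open>1 - cos (\<xi>s)\<close> is of order \<open>(\<xi>s)\<^sup>2\<close>. Lower scaling says that these jumps carry a fixed part of \<open>\<sigma> R\<close>:
  in \<open>\<sigma> (lR)\<close> the jumps \<open>s > 1/R\<close> contribute at most \<open>exp (- (l - 1)) \<sigma> R\<close>, which for a large
  constant \<open>l\<close> is at most half of the lower bound \<open>c l\<^sup>\<tau> \<sigma> R\<close>.
\<close>

lemma real_part_ge:
  assumes "0 < c" "0 \<le> x\<^sub>0"
    and scaling: "\<And>l x. 1 \<le> l \<Longrightarrow> x\<^sub>0 < x \<Longrightarrow> c * l powr \<tau> * \<sigma> x \<le> \<sigma> (l * x)"
  obtains C where "0 < C"
    "\<And>w \<xi>. x\<^sub>0 < w \<Longrightarrow> C * \<xi>\<^sup>2 * \<sigma> (max \<bar>\<xi>\<bar> w) \<le> (\<integral>s. (1 - cos (\<xi> * s)) * exp (- (w * s)) \<partial>\<nu>)"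
proof -
  have "((\<lambda>l::real. l powr (- \<tau>) * exp (- (l - 1))) \<longlongrightarrow> 0) at_top" by real_asymp
  then have "\<forall>\<^sub>F l in at_top. l powr (- \<tau>) * exp (- (l - 1)) < c / 2 \<and> 1 \<le> l"
    using assms by (intro eventually_conj order_tendstoD(2) eventually_ge_at_top) auto
  then obtain l where l: "l powr (- \<tau>) * exp (- (l - 1)) < c / 2" "1 \<le> l"
    by (auto simp: eventually_at_top_linorder)
  then have l': "exp (- (l - 1)) \<le> c * l powr \<tau> / 2"
    by (simp add: powr_minus field_simps)
  define C where "C = c * l powr \<tau> / 2"
  have "0 < C" using assms l by (simp add: C_def)
  have V: "C * \<sigma> R \<le> (\<integral>s. indicator {..1 / R} s * (s\<^sup>2 * exp (- (R * s))) \<partial>\<nu>)" if "x\<^sub>0 < R" for R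
  proof -
    let ?V = "\<lambda>s. indicator {..1 / R} s * (s\<^sup>2 * exp (- (R * s)))"
    have "0 < R" using that assms by simp
    have int: "integrable \<nu> ?V"
      by (rule Bochner_Integration.integrable_bound[OF integrable_sigma[OF \<open>0 < R\<close>]])
         (auto simp: indicator_def)
    have "2 * C * \<sigma> R \<le> \<sigma> (l * R)"
      using scaling[OF l(2) that] by (simp add: C_def)
    also have "\<dots> \<le> (\<integral>s. ?V s + C * (s\<^sup>2 * exp (- (R * s))) \<partial>\<nu>)"
      unfolding \<sigma>_def
    proof (rule integral_mono_AE)
      show "AE s in \<nu>. s\<^sup>2 * exp (- ((l * R) * s)) \<le> ?V s + C * (s\<^sup>2 * exp (- (R * s)))"
        using AE_nu_pos
      proof eventually_elim
        case (elim s)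
        show ?case
        proof (cases "s \<le> 1 / R")
          case True
          have "- (l * R) * s \<le> - R * s" using l elim \<open>0 < R\<close> by simp
          then have "s\<^sup>2 * exp (- ((l * R) * s)) \<le> ?V s" using True by (simp add: mult_left_mono)
          moreover have "0 \<le> C * (s\<^sup>2 * exp (- (R * s)))" using \<open>0 < C\<close> by simp
          ultimately show ?thesis by linarith
        next
          case False
          then have "1 \<le> R * s" using \<open>0 < R\<close> by (simp add: field_simps)
          then have "(l - 1) * 1 \<le> (l - 1) * (R * s)" using l by (intro mult_left_mono) auto
          then have "exp (- ((l * R) * s)) \<le> exp (- (l - 1) + - (R * s))"
            by (simp add: algebra_simps)
          also have "\<dots> \<le> C * exp (- (R * s))"
            unfolding exp_add using l' by (intro mult_right_mono) (auto simp: C_def)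
          finally have "s\<^sup>2 * exp (- ((l * R) * s)) \<le> s\<^sup>2 * (C * exp (- (R * s)))"
            by (rule mult_left_mono) simp
          then show ?thesis using False by (simp add: mult_ac)
        qed
      qed
    qed (use int integrable_sigma l \<open>0 < R\<close> in auto)
    also have "\<dots> = (\<integral>s. ?V s \<partial>\<nu>) + C * \<sigma> R"
      using int integrable_sigma[OF \<open>0 < R\<close>] by (simp add: \<sigma>_def)
    finally show ?thesis by simp
  qed
  show ?thesis
  proof (rule that)
    show "0 < C / 4" using \<open>0 < C\<close> by simp
    fix w \<xi> :: real assume w: "x\<^sub>0 < w"
    then have "0 < w" using assms by simp
    define R where "R = max \<bar>\<xi>\<bar> w"
    have R: "x\<^sub>0 < R" "0 < R" "w \<le> R" "\<bar>\<xi>\<bar> \<le> R" using w \<open>0 < w\<close> by (auto simp: R_def)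
    have "C / 4 * \<xi>\<^sup>2 * \<sigma> R \<le> \<xi>\<^sup>2 / 4 * (\<integral>s. indicator {..1 / R} s * (s\<^sup>2 * exp (- (R * s))) \<partial>\<nu>)"
      using mult_left_mono[OF V[OF R(1)], of "\<xi>\<^sup>2 / 4"] by (simp add: mult_ac)
    also have "\<dots> = (\<integral>s. \<xi>\<^sup>2 / 4 * (indicator {..1 / R} s * (s\<^sup>2 * exp (- (R * s)))) \<partial>\<nu>)"
      by simp
    also have "\<dots> \<le> (\<integral>s. (1 - cos (\<xi> * s)) * exp (- (w * s)) \<partial>\<nu>)"
    proof (rule integral_mono_AE)
      show "integrable \<nu> (\<lambda>s. \<xi>\<^sup>2 / 4 * (indicator {..1 / R} s * (s\<^sup>2 * exp (- (R * s)))))"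
        by (rule Bochner_Integration.integrable_bound[OF integrable_mult_right[OF integrable_sigma[OF \<open>0 < R\<close>], of "\<xi>\<^sup>2 / 4"]])
           (auto simp: indicator_def)
      have "integrable \<nu> (\<lambda>s. Re (1 - exp (- ((w - \<i> * \<xi>) * complex_of_real s))) - Re (1 - exp (- (complex_of_real w * complex_of_real s))))"
        using \<open>0 < w\<close> by (intro Bochner_Integration.integrable_diff integrable_Re integrable_one_minus_exp) auto
      then show "integrable \<nu> (\<lambda>s. (1 - cos (\<xi> * s)) * exp (- (w * s)))"
        by (simp add: Re_exp algebra_simps)
      show "AE s in \<nu>. \<xi>\<^sup>2 / 4 * (indicator {..1 / R} s * (s\<^sup>2 * exp (- (R * s)))) \<le> (1 - cos (\<xi> * s)) * exp (- (w * s))"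
        using AE_nu_pos
      proof eventually_elim
        case (elim s)
        show ?case
        proof (cases "s \<le> 1 / R")
          case True
          have "\<bar>\<xi> * s\<bar> \<le> R * (1 / R)"
            unfolding abs_mult using R elim True by (intro mult_mono) auto
          then have "\<bar>\<xi> * s\<bar> \<le> 1" using R by simp
          then have "(\<xi> * s)\<^sup>2 / 4 * exp (- (R * s)) \<le> (1 - cos (\<xi> * s)) * exp (- (w * s))"
            using R elim by (intro mult_mono one_minus_cos_ge) auto
          then show ?thesis using True by (simp add: power_mult_distrib mult_ac)
        qed simp
      qed
    qed
    finally show "C / 4 * \<xi>\<^sup>2 * \<sigma> (max \<bar>\<xi>\<bar> w) \<le> (\<integral>s. (1 - cos (\<xi> * s)) * exp (- (w * s)) \<partial>\<nu>)"
      by (simp add: R_def)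
  qed
qed

section \<open>Tilted laws\<close>

text \<open>
  Both sides are holomorphic in the right half-plane and agree on the positive half-line, so they
  agree by the identity theorem.
\<close>

lemma laplace_transform_extension:
  assumes "real_distribution \<mu>" and nonneg: "AE x in \<mu>. 0 \<le> x"
    and laplace: "\<And>u. 0 < u \<Longrightarrow> (\<integral>x. exp (- (u * x)) \<partial>\<mu>) = exp (- (t * \<phi> u))"
    and z: "0 < Re z"
  shows "(\<integral>x. exp (- (z * of_real x)) \<partial>\<mu>) = exp (- (of_real t * \<Phi> z))"
proof -
  interpret real_distribution \<mu> by fact
  let ?H = "{z. 0 < Re z}"
  have int: "complex_integrable \<mu> (\<lambda>x. exp (- (z * of_real x)))" if "0 < Re z" for z
  proof (rule integrable_const_bound[where B = 1])
    show "AE x in \<mu>. norm (exp (- (z * complex_of_real x))) \<le> 1"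
      using nonneg by eventually_elim (use that in simp)
  qed measurable
  \<comment> \<open>\<open>x exp (- Re y x) \<le> 2 / Re z\<close> when \<open>Re y > Re z / 2\<close>, so a constant dominates the derivative.\<close>
  let ?L = "\<lambda>z. \<integral>x. exp (- (z * complex_of_real x)) \<partial>\<mu>"
  have "(?L has_field_derivative (\<integral>x. - of_real x * exp (- (z * of_real x)) \<partial>\<mu>)) (at z)" if z: "0 < Re z" for z
  proof (rule has_field_derivative_integral[where S = "{x. Re x > Re z / 2}" and h = "\<lambda>x. 2 / Re z"
        and f' = "\<lambda>z x. - of_real x * exp (- (z * of_real x))"])
    show "open {x. Re x > Re z / 2}" "convex {x. Re x > Re z / 2}"
      by (rule open_halfspace_Re_gt convex_halfspace_Re_gt)+
    show "complex_integrable \<mu> (\<lambda>x. exp (- (y * of_real x)))" if "y \<in> {x. Re x > Re z / 2}" for y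
      using that z by (intro int) auto
    show "AE x in \<mu>. \<forall>y\<in>{x. Re x > Re z / 2}. ((\<lambda>y. exp (- (y * complex_of_real x))) has_field_derivative - of_real x * exp (- (y * of_real x))) (at y) \<and>
          norm (- of_real x * exp (- (y * complex_of_real x))) \<le> 2 / Re z"
      using nonneg
    proof eventually_elim
      case (elim x)
      have "x * exp (- (Re y * x)) \<le> 2 / Re z" if "Re y > Re z / 2" for y
      proof -
        have "Re z / 2 * x \<le> Re y * x" using that elim by (intro mult_right_mono) auto
        also have "\<dots> \<le> exp (Re y * x)" using exp_ge_add_one_self[of "Re y * x"] by linarith
        finally show ?thesis using z by (simp add: exp_minus field_simps)
      qed
      then show ?case
        using elim by (auto intro!: derivative_eq_intros simp: norm_mult)
    qed
  qed (use z in auto)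
  then have holo: "?L holomorphic_on ?H"
    by (subst holomorphic_on_open) (auto simp: open_halfspace_Re_gt)
  have "\<Phi> holomorphic_on ?H"
    using Phi_has_field_derivative by (subst holomorphic_on_open) (auto simp: open_halfspace_Re_gt)
  then have "(\<lambda>z. ?L z - exp (- (of_real t * \<Phi> z))) holomorphic_on ?H"
    by (intro holomorphic_intros holo)
  then have "?L z - exp (- (of_real t * \<Phi> z)) = 0"
  proof (rule analytic_continuation[where U = "of_real ` {0<..}" and \<xi> = 1])
    show "open ?H" "connected ?H"
      by (auto simp: open_halfspace_Re_gt intro!: convex_connected convex_halfspace_Re_gt)
    show "1 islimpt (of_real ` {0<..} :: complex set)"
      unfolding islimpt_approachable
    proof (intro allI impI)
      fix e :: real assume "0 < e"
      then show "\<exists>x'\<in>of_real ` {0<..}. x' \<noteq> (1::complex) \<and> dist x' 1 < e"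
        by (intro bexI[of _ "of_real (1 + e / 2)"] imageI) (auto simp: dist_norm)
    qed
    show "?L x - exp (- (of_real t * \<Phi> x)) = 0" if "x \<in> of_real ` {0<..}" for x
    proof -
      obtain u where u: "x = of_real u" "0 < u" using \<open>x \<in> of_real ` {0<..}\<close> by auto
      have "?L x = (\<integral>x. complex_of_real (exp (- (u * x))) \<partial>\<mu>)"
        unfolding u by (simp flip: exp_of_real)
      also have "\<dots> = of_real (exp (- (t * \<phi> u)))"
        unfolding integral_complex_of_real laplace[OF u(2)] ..
      also have "\<dots> = exp (- (of_real t * \<Phi> x))"
        using u Phi_of_real[of u] by (simp flip: exp_of_real)
      finally show ?thesis by simp
    qed
  qed (use z in auto)
  then show ?thesis by simp
qed

text \<open>
  \<open>\<Phi>\<close> centred at \<open>w\<close> along the vertical line: \<open>\<lambda>\<xi>. exp (t \<Psi> w \<xi>)\<close> is the characteristic function of the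
  tilted and centred law of the subordinator at time \<open>t\<close>.
\<close>

definition \<Psi> :: "real \<Rightarrow> real \<Rightarrow> complex" where
  "\<Psi> w \<xi> = of_real (\<phi> w) - \<Phi> (of_real w - \<i> * of_real \<xi>) - \<i> * of_real (\<xi> * deriv \<phi> w)"

lemma
  assumes "0 < w"
  shows integrable_Psi: "complex_integrable \<nu> (\<lambda>s. (iexp (\<xi> * s) - 1 - \<i> * of_real (\<xi> * s)) * of_real (exp (- (w * s))))"
    and Psi_eq: "\<Psi> w \<xi> = (\<integral>s. (iexp (\<xi> * s) - 1 - \<i> * of_real (\<xi> * s)) * of_real (exp (- (w * s))) \<partial>\<nu>)"
proof -
  let ?z = "of_real w - \<i> * of_real \<xi>"
  have 1: "complex_integrable \<nu> (\<lambda>s. 1 - exp (- (of_real w * complex_of_real s)))"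
    and 2: "complex_integrable \<nu> (\<lambda>s. 1 - exp (- (?z * complex_of_real s)))"
    using assms by (auto intro!: integrable_one_minus_exp)
  have 3: "complex_integrable \<nu> (\<lambda>s. \<i> * of_real \<xi> * of_real (s * exp (- (w * s))))"
    using integrable_moment[of w 1] assms by (intro integrable_mult_right integrable_of_real) auto
  have eq: "(iexp (\<xi> * s) - 1 - \<i> * of_real (\<xi> * s)) * of_real (exp (- (w * s))) =
     (1 - exp (- (of_real w * complex_of_real s))) - (1 - exp (- (?z * complex_of_real s))) - \<i> * of_real \<xi> * of_real (s * exp (- (w * s)))" for s
    by (simp add: algebra_simps exp_diff exp_minus exp_of_real divide_inverse flip: exp_of_real)
  show "complex_integrable \<nu> (\<lambda>s. (iexp (\<xi> * s) - 1 - \<i> * of_real (\<xi> * s)) * of_real (exp (- (w * s))))"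
    unfolding eq by (intro Bochner_Integration.integrable_diff 1 2 3)
  have "(\<integral>s. (iexp (\<xi> * s) - 1 - \<i> * of_real (\<xi> * s)) * of_real (exp (- (w * s))) \<partial>\<nu>) =
      (\<Phi> w - of_real (b * w)) - (\<Phi> ?z - of_real b * ?z) - \<i> * of_real \<xi> * of_real (\<integral>s. s * exp (- (w * s)) \<partial>\<nu>)"
    unfolding eq Bochner_Integration.integral_diff[OF Bochner_Integration.integrable_diff[OF 1 2] 3]
      Bochner_Integration.integral_diff[OF 1 2] integral_mult_right_zero integral_complex_of_real
    by (simp add: \<Phi>_def)
  also have "\<dots> = \<Psi> w \<xi>"
    using assms by (simp add: \<Psi>_def deriv_exponent Phi_of_real algebra_simps)
  finally show "\<Psi> w \<xi> = (\<integral>s. (iexp (\<xi> * s) - 1 - \<i> * of_real (\<xi> * s)) * of_real (exp (- (w * s))) \<partial>\<nu>)" ..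
qed

lemma Re_Psi:
  assumes "0 < w"
  shows "Re (\<Psi> w \<xi>) = - (\<integral>s. (1 - cos (\<xi> * s)) * exp (- (w * s)) \<partial>\<nu>)"
proof -
  have "Re (\<Psi> w \<xi>) = (\<integral>s. Re ((iexp (\<xi> * s) - 1 - \<i> * of_real (\<xi> * s)) * of_real (exp (- (w * s)))) \<partial>\<nu>)"
    unfolding Psi_eq[OF assms] using integrable_Psi[OF assms] by (rule integral_Re[symmetric])
  also have "\<dots> = (\<integral>s. - ((1 - cos (\<xi> * s)) * exp (- (w * s))) \<partial>\<nu>)"
    by (simp add: Re_exp algebra_simps)
  finally show ?thesis by simp
qed

text \<open>The Gaussian approximation of \<open>\<Psi> w\<close>, with an error controlled by the third moment.\<close>

lemma Psi_approx:
  assumes "0 < w"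
  shows "norm (\<Psi> w \<xi> + of_real (\<xi>\<^sup>2 / 2 * \<sigma> w)) \<le> \<bar>\<xi>\<bar> ^ 3 / (3 * w) * \<sigma> (w / 2)"
proof -
  let ?g = "\<lambda>s. (iexp (\<xi> * s) - 1 - \<i> * of_real (\<xi> * s)) * of_real (exp (- (w * s)))"
  have int: "complex_integrable \<nu> (\<lambda>s. of_real (\<xi>\<^sup>2 / 2) * of_real (s\<^sup>2 * exp (- (w * s))))"
    using integrable_sigma[OF assms] by (intro integrable_mult_right integrable_of_real)
  have "\<Psi> w \<xi> + of_real (\<xi>\<^sup>2 / 2 * \<sigma> w) =
      (\<integral>s. ?g s \<partial>\<nu>) + of_real (\<xi>\<^sup>2 / 2) * (\<integral>s. of_real (s\<^sup>2 * exp (- (w * s))) \<partial>\<nu>)"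
    unfolding Psi_eq[OF assms] \<sigma>_def integral_complex_of_real by simp
  also have "\<dots> = (\<integral>s. ?g s + of_real (\<xi>\<^sup>2 / 2) * of_real (s\<^sup>2 * exp (- (w * s))) \<partial>\<nu>)"
    by (subst Bochner_Integration.integral_add[OF integrable_Psi[OF assms] int]) simp
  finally have eq: "\<Psi> w \<xi> + of_real (\<xi>\<^sup>2 / 2 * \<sigma> w) =
      (\<integral>s. ?g s + of_real (\<xi>\<^sup>2 / 2) * of_real (s\<^sup>2 * exp (- (w * s))) \<partial>\<nu>)" .
  have "norm (\<Psi> w \<xi> + of_real (\<xi>\<^sup>2 / 2 * \<sigma> w)) \<le> (\<integral>s. \<bar>\<xi>\<bar> ^ 3 / 6 * (s ^ 3 * exp (- (w * s))) \<partial>\<nu>)"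
    unfolding eq
  proof (rule order.trans[OF integral_norm_bound], rule integral_mono_AE)
    show "integrable \<nu> (\<lambda>s. norm (?g s + of_real (\<xi>\<^sup>2 / 2) * of_real (s\<^sup>2 * exp (- (w * s)))))"
      by (intro integrable_norm Bochner_Integration.integrable_add integrable_Psi[OF assms] int)
    show "integrable \<nu> (\<lambda>s. \<bar>\<xi>\<bar> ^ 3 / 6 * (s ^ 3 * exp (- (w * s))))"
      using assms by (intro integrable_mult_right integrable_moment) auto
    show "AE s in \<nu>. norm (?g s + of_real (\<xi>\<^sup>2 / 2) * of_real (s\<^sup>2 * exp (- (w * s)))) \<le> \<bar>\<xi>\<bar> ^ 3 / 6 * (s ^ 3 * exp (- (w * s)))"
      using AE_nu_pos
    proof eventually_elim
      case (elim s)
      have taylor: "(\<Sum>k\<le>2. (\<i> * of_real (\<xi> * s)) ^ k / fact k) = 1 + \<i> * of_real (\<xi> * s) - of_real (\<xi>\<^sup>2 / 2 * s\<^sup>2)"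
        by (simp add: eval_nat_numeral power_mult_distrib)
      have eq': "?g s + of_real (\<xi>\<^sup>2 / 2) * of_real (s\<^sup>2 * exp (- (w * s))) =
          (iexp (\<xi> * s) - (\<Sum>k\<le>2. (\<i> * of_real (\<xi> * s)) ^ k / fact k)) * of_real (exp (- (w * s)))"
        unfolding taylor by (simp add: algebra_simps)
      have "norm (?g s + of_real (\<xi>\<^sup>2 / 2) * of_real (s\<^sup>2 * exp (- (w * s)))) \<le> \<bar>\<xi> * s\<bar> ^ 3 / 6 * exp (- (w * s))"
        unfolding eq' using iexp_approx1[of "\<xi> * s" 2]
        by (subst norm_mult) (auto intro!: mult_mono simp: fact_numeral numeral_3_eq_3)
      then show ?case
        using elim by (simp add: abs_mult power_mult_distrib mult_ac)
    qed
  qed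
  also have "\<dots> = \<bar>\<xi>\<bar> ^ 3 / 6 * (\<integral>s. s ^ 3 * exp (- (w * s)) \<partial>\<nu>)"
    by (rule integral_mult_right_zero)
  also have "\<dots> \<le> \<bar>\<xi>\<bar> ^ 3 / 6 * (2 / w * \<sigma> (w / 2))"
    by (intro mult_left_mono third_moment_le assms) simp
  finally show ?thesis by (simp add: field_simps)
qed

lemma continuous_Psi:
  assumes "0 < w"
  shows "continuous_on UNIV (\<Psi> w)"
proof -
  have cont: "continuous_on {z. 0 < Re z} \<Phi>"
    using Phi_has_field_derivative by (intro DERIV_continuous_on) (auto intro: has_field_derivative_at_within)
  have "continuous_on UNIV (\<lambda>\<xi>. complex_of_real w - \<i> * of_real \<xi>)"
    by (intro continuous_intros)
  then have "continuous_on UNIV (\<lambda>\<xi>. \<Phi> (of_real w - \<i> * of_real \<xi>))"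
    by (rule continuous_on_compose2[OF cont]) (use assms in auto)
  then show ?thesis
    unfolding \<Psi>_def[abs_def] by (intro continuous_intros)
qed

text \<open>
  Weighting \<open>\<mu>\<close> with \<open>exp (t \<phi>(w) - w x)\<close> gives a probability measure with mean \<open>t \<phi>'(w)\<close> and characteristic
  function \<open>exp (t \<Psi> w \<xi> + \<i>\<xi> t \<phi>'(w))\<close>. Fourier inversion for the tilted measure at its mean gives the
  density of \<open>\<mu>\<close> at that point.
\<close>

lemma tilted_density:
  assumes rd: "real_distribution \<mu>" and nonneg: "AE x in \<mu>. 0 \<le> x"
    and laplace: "\<And>u. 0 < u \<Longrightarrow> (\<integral>x. exp (- (u * x)) \<partial>\<mu>) = exp (- (t * \<phi> u))"
    and w: "0 < w"
    and int: "integrable lborel (\<lambda>\<xi>. exp (of_real t * \<Psi> w \<xi>))"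
  shows "\<exists>q. continuous_on UNIV q \<and> (\<forall>x. 0 \<le> q x) \<and> \<mu> = density lborel (\<lambda>x. ennreal (q x)) \<and>
     q (t * deriv \<phi> w) * exp (t * (\<phi> w - w * deriv \<phi> w)) =
       1 / (2 * pi) * (\<integral>\<xi>. Re (exp (of_real t * \<Psi> w \<xi>)) \<partial>lborel)"
proof -
  interpret real_distribution \<mu> by fact
  define d where "d x = exp (t * \<phi> w - w * x)" for x
  have [measurable]: "d \<in> borel_measurable borel" unfolding d_def[abs_def] by measurable
  have d_eq: "d x = exp (t * \<phi> w) * exp (- (w * x))" for x
    by (simp add: d_def exp_diff exp_minus field_simps)
  define \<rho> where "\<rho> = density \<mu> (\<lambda>x. ennreal (d x))"
  have int_w: "integrable \<mu> (\<lambda>x. exp (- (w * x)))"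
  proof (rule integrable_const_bound[where B = 1])
    show "AE x in \<mu>. norm (exp (- (w * x))) \<le> 1"
      using nonneg by eventually_elim (use w in simp)
  qed measurable
  have "(\<integral>\<^sup>+x. ennreal (d x) \<partial>\<mu>) = ennreal (\<integral>x. d x \<partial>\<mu>)"
    using int_w by (intro nn_integral_eq_integral) (auto simp: d_eq)
  also have "(\<integral>x. d x \<partial>\<mu>) = 1"
    using laplace[OF w] by (simp add: d_eq exp_minus)
  finally have "prob_space \<rho>"
    unfolding \<rho>_def by (intro prob_spaceI) (simp add: emeasure_density cong: nn_integral_cong)
  then interpret \<rho>: real_distribution \<rho>
    by (simp add: real_distribution_def real_distribution_axioms_def \<rho>_def)
  have char_\<rho>: "char \<rho> \<xi> = exp (of_real t * \<Psi> w \<xi>) * iexp (\<xi> * (t * deriv \<phi> w))" for \<xi>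
  proof -
    let ?z = "of_real w - \<i> * of_real \<xi>"
    have "char \<rho> \<xi> = (\<integral>x. d x *\<^sub>R iexp (\<xi> * x) \<partial>\<mu>)"
      unfolding char_def \<rho>_def by (subst integral_density) (auto simp: d_def)
    also have "\<dots> = (\<integral>x. exp (of_real (t * \<phi> w)) * exp (- (?z * of_real x)) \<partial>\<mu>)"
      by (intro Bochner_Integration.integral_cong refl)
         (simp add: d_def scaleR_conv_of_real flip: exp_of_real exp_add, simp add: algebra_simps)
    also have "\<dots> = exp (of_real (t * \<phi> w)) * exp (- (of_real t * \<Phi> ?z))"
      using laplace_transform_extension[OF rd nonneg laplace, of ?z] w by simp
    also have "\<dots> = exp (of_real t * \<Psi> w \<xi>) * iexp (\<xi> * (t * deriv \<phi> w))"
      by (simp add: \<Psi>_def algebra_simps flip: exp_add)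
    finally show ?thesis .
  qed
  have "integrable lborel (char \<rho>)"
  proof (rule Bochner_Integration.integrable_bound[OF int])
    show "AE \<xi> in lborel. norm (char \<rho> \<xi>) \<le> norm (exp (of_real t * \<Psi> w \<xi>))"
      by (simp add: char_\<rho> norm_mult)
  qed measurable
  note inversion = \<rho>.integrable_char_imp_continuous_density[OF this]
  define f where "f x = 1 / (2 * pi) * (\<integral>\<xi>. Re (iexp (- (\<xi> * x)) * char \<rho> \<xi>) \<partial>lborel)" for x
  have inv: "continuous_on UNIV f" "\<And>x. 0 \<le> f x" "\<rho> = density lborel (\<lambda>x. ennreal (f x))"
    unfolding f_def[abs_def] by (fact inversion)+
  have [measurable]: "f \<in> borel_measurable borel"
    using inv(1) by (rule borel_measurable_continuous_onI)
  define q where "q x = exp (w * x - t * \<phi> w) * f x" for x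
  have "\<mu> = density \<mu> (\<lambda>x. ennreal (d x) * ennreal (exp (w * x - t * \<phi> w)))"
    by (simp add: d_def density_1 flip: ennreal_mult' exp_add)
  also have "\<dots> = density \<rho> (\<lambda>x. ennreal (exp (w * x - t * \<phi> w)))"
    unfolding \<rho>_def by (subst density_density_eq) auto
  also have "\<dots> = density (density lborel (\<lambda>x. ennreal (f x))) (\<lambda>x. ennreal (exp (w * x - t * \<phi> w)))"
    using inv(3) by simp
  also have "\<dots> = density lborel (\<lambda>x. ennreal (q x))"
    using inv(2) by (subst density_density_eq) (auto simp: q_def mult.commute ennreal_mult)
  finally have dens: "\<mu> = density lborel (\<lambda>x. ennreal (q x))" .
  have "continuous_on UNIV q"
    unfolding q_def[abs_def] by (intro continuous_intros inv(1))
  moreover have "0 \<le> q x" for x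
    unfolding q_def using inv(2) by simp
  moreover have "q (t * deriv \<phi> w) * exp (t * (\<phi> w - w * deriv \<phi> w)) = f (t * deriv \<phi> w)"
  proof -
    have "exp (w * (t * deriv \<phi> w) - t * \<phi> w) * exp (t * (\<phi> w - w * deriv \<phi> w)) = 1"
      by (simp add: algebra_simps flip: exp_add)
    then show ?thesis unfolding q_def by (metis mult.commute mult.left_commute mult_1)
  qed
  moreover have "iexp (- (\<xi> * (t * deriv \<phi> w))) * char \<rho> \<xi> = exp (of_real t * \<Psi> w \<xi>)" for \<xi>
    unfolding char_\<rho> by (simp add: algebra_simps exp_minus)
  then have "f (t * deriv \<phi> w) = 1 / (2 * pi) * (\<integral>\<xi>. Re (exp (of_real t * \<Psi> w \<xi>)) \<partial>lborel)"
    unfolding f_def by (simp only:)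
  ultimately show ?thesis
    using dens by (intro exI[of _ q]) simp
qed

end

section \<open>Consequences of lower scaling\<close>

text \<open>
  The lower scaling condition in terms of \<open>\<sigma>\<close>, for a nonzero \<open>\<nu>\<close>. Requiring \<open>\<alpha> \<le> 2\<close> is harmless, since lowering \<open>\<alpha>\<close> weakens the
  condition.
\<close>

locale scaled_levy_triplet = levy_triplet +
  fixes c x\<^sub>0 \<alpha> :: real
  assumes c_pos: "0 < c" and c_le: "c \<le> 1" and x0_nonneg: "0 \<le> x\<^sub>0" and alpha_pos: "0 < \<alpha>" and alpha_le: "\<alpha> \<le> 2"
    and scaling: "\<And>l x. 1 \<le> l \<Longrightarrow> x\<^sub>0 < x \<Longrightarrow> c * l powr (\<alpha> - 2) * \<sigma> x \<le> \<sigma> (l * x)"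
    and sigma_pos': "\<And>x. 0 < x \<Longrightarrow> 0 < \<sigma> x"
begin

text \<open>
  For \<open>w > 2 x\<^sub>0\<close> this is scaling by the factor \<open>2\<close>. In the remaining range \<open>x\<^sub>0 < w \<le> 2 x\<^sub>0\<close>, which is
  nonempty only if \<open>x\<^sub>0 > 0\<close>, the monotone function \<open>\<sigma>\<close> is bounded and bounded away from \<open>0\<close>.
\<close>

lemma sigma_half_le:
  obtains K where "0 < K" "\<And>w. x\<^sub>0 < w \<Longrightarrow> \<sigma> (w / 2) \<le> K * \<sigma> w"
proof -
  define K1 where "K1 = 1 / (c * 2 powr (\<alpha> - 2))"
  have "0 < K1" using c_pos by (simp add: K1_def)
  have K1: "\<sigma> (w / 2) \<le> K1 * \<sigma> w" if "2 * x\<^sub>0 < w" for w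
    using scaling[of 2 "w / 2"] that c_pos by (simp add: K1_def field_simps)
  show ?thesis
  proof (cases "x\<^sub>0 = 0")
    case True
    then show ?thesis using that[OF \<open>0 < K1\<close>] K1 by simp
  next
    case False
    then have x0: "0 < x\<^sub>0" using x0_nonneg by simp
    define K2 where "K2 = \<sigma> (x\<^sub>0 / 2) / \<sigma> (2 * x\<^sub>0)"
    have "0 < K2" using x0 sigma_pos' by (simp add: K2_def)
    show ?thesis
    proof (rule that)
      show "0 < max K1 K2" using \<open>0 < K1\<close> by simp
      fix w assume w: "x\<^sub>0 < w"
      have pos: "0 < \<sigma> w" using w x0 sigma_pos' by simp
      show "\<sigma> (w / 2) \<le> max K1 K2 * \<sigma> w"
      proof (cases "2 * x\<^sub>0 < w")
        case True
        then have "\<sigma> (w / 2) \<le> K1 * \<sigma> w" by (rule K1)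
        also have "\<dots> \<le> max K1 K2 * \<sigma> w" using pos by (intro mult_right_mono) auto
        finally show ?thesis .
      next
        case False
        have "\<sigma> (w / 2) \<le> \<sigma> (x\<^sub>0 / 2)" using w x0 by (intro sigma_antimono) auto
        also have "\<dots> = K2 * \<sigma> (2 * x\<^sub>0)" using sigma_pos'[of "2 * x\<^sub>0"] x0 by (simp add: K2_def)
        also have "\<dots> \<le> K2 * \<sigma> w" using False w x0 \<open>0 < K2\<close> by (intro mult_left_mono sigma_antimono) auto
        also have "\<dots> \<le> max K1 K2 * \<sigma> w" using pos by (intro mult_right_mono) auto
        finally show ?thesis .
      qed
    qed
  qed
qed

text \<open>
  Gaussian decay for \<open>\<bar>\<xi>\<bar> \<le> w\<close>, and decay of order \<open>\<alpha>\<close> beyond: there \<open>\<xi>\<^sup>2 \<sigma> \<bar>\<xi>\<bar>\<close> is compared with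
  \<open>w\<^sup>2 \<sigma> w\<close> by scaling from \<open>w\<close> to \<open>\<bar>\<xi>\<bar>\<close>.
\<close>

lemma norm_exp_Psi_le:
  obtains C where "0 < C"
    "\<And>t w \<xi>. 0 < t \<Longrightarrow> x\<^sub>0 < w \<Longrightarrow> \<bar>\<xi>\<bar> \<le> w \<Longrightarrow> norm (exp (of_real t * \<Psi> w \<xi>)) \<le> exp (- (C * (t * \<xi>\<^sup>2 * \<sigma> w)))"
    "\<And>t w \<xi>. 0 < t \<Longrightarrow> x\<^sub>0 < w \<Longrightarrow> w \<le> \<bar>\<xi>\<bar> \<Longrightarrow>
       norm (exp (of_real t * \<Psi> w \<xi>)) \<le> exp (- (C * (t * w\<^sup>2 * \<sigma> w) * (\<bar>\<xi>\<bar> / w) powr \<alpha>))"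
proof -
  obtain C where C: "0 < C"
    "\<And>w \<xi>. x\<^sub>0 < w \<Longrightarrow> C * \<xi>\<^sup>2 * \<sigma> (max \<bar>\<xi>\<bar> w) \<le> (\<integral>s. (1 - cos (\<xi> * s)) * exp (- (w * s)) \<partial>\<nu>)"
    using real_part_ge[OF c_pos x0_nonneg scaling] by metis
  have bound: "norm (exp (of_real t * \<Psi> w \<xi>)) \<le> exp (- (C * \<xi>\<^sup>2 * \<sigma> (max \<bar>\<xi>\<bar> w) * t))" if "0 < t" "x\<^sub>0 < w" for t w \<xi>
    using mult_left_mono[OF C(2)[OF that(2), of \<xi>], of t] that x0_nonneg by (simp add: Re_Psi mult_ac)
  show thesis
  proof (rule that)
    show "0 < C * c" using C c_pos by simp
    fix t w \<xi> :: real assume t: "0 < t" and w: "x\<^sub>0 < w"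
    have w': "0 < w" using w x0_nonneg by simp
    { assume "\<bar>\<xi>\<bar> \<le> w"
      then have "norm (exp (of_real t * \<Psi> w \<xi>)) \<le> exp (- (C * \<xi>\<^sup>2 * \<sigma> w * t))"
        using bound[OF t w, of \<xi>] by (simp add: max_absorb2)
      also have "C * c * (t * \<xi>\<^sup>2 * \<sigma> w) \<le> C * 1 * (t * \<xi>\<^sup>2 * \<sigma> w)"
        using C c_le t sigma_nonneg by (intro mult_right_mono mult_left_mono) auto
      then have "exp (- (C * \<xi>\<^sup>2 * \<sigma> w * t)) \<le> exp (- (C * c * (t * \<xi>\<^sup>2 * \<sigma> w)))"
        by (simp add: mult_ac)
      finally show "norm (exp (of_real t * \<Psi> w \<xi>)) \<le> exp (- (C * c * (t * \<xi>\<^sup>2 * \<sigma> w)))" . }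
    { assume xi: "w \<le> \<bar>\<xi>\<bar>"
      define l where "l = \<bar>\<xi>\<bar> / w"
      have l: "1 \<le> l" "\<bar>\<xi>\<bar> = l * w" using xi w' by (auto simp: l_def)
      have sq: "\<xi>\<^sup>2 = l\<^sup>2 * w\<^sup>2" using l(2) by (metis power2_abs power_mult_distrib)
      have "norm (exp (of_real t * \<Psi> w \<xi>)) \<le> exp (- (C * \<xi>\<^sup>2 * \<sigma> (l * w) * t))"
        using bound[OF t w, of \<xi>] xi l(2) by (simp add: max_absorb1)
      moreover have "C * \<xi>\<^sup>2 * t * (c * l powr (\<alpha> - 2) * \<sigma> w) \<le> C * \<xi>\<^sup>2 * t * \<sigma> (l * w)"
        using C t scaling[OF l(1) w] by (intro mult_left_mono) auto
      moreover have "l\<^sup>2 * l powr (\<alpha> - 2) = l powr \<alpha>"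
      proof -
        have "l\<^sup>2 = l powr 2" using l by (simp flip: powr_numeral)
        then show ?thesis by (simp flip: powr_add)
      qed
      then have "C * \<xi>\<^sup>2 * t * (c * l powr (\<alpha> - 2) * \<sigma> w) = C * c * (t * w\<^sup>2 * \<sigma> w) * l powr \<alpha>"
        unfolding sq by (simp add: mult_ac)
      ultimately have "norm (exp (of_real t * \<Psi> w \<xi>)) \<le> exp (- (C * c * (t * w\<^sup>2 * \<sigma> w) * l powr \<alpha>))"
        by (smt (verit) exp_le_cancel_iff mult.commute mult.left_commute)
      then show "norm (exp (of_real t * \<Psi> w \<xi>)) \<le> exp (- (C * c * (t * w\<^sup>2 * \<sigma> w) * (\<bar>\<xi>\<bar> / w) powr \<alpha>))"
        by (simp add: l_def) }
  qed
qed

lemma norm_exp_Psi_le_1: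
  assumes "0 < t" "x\<^sub>0 < w"
  shows "norm (exp (of_real t * \<Psi> w \<xi>)) \<le> 1"
proof -
  obtain C where C: "0 < C"
    "\<And>t w \<xi>. 0 < t \<Longrightarrow> x\<^sub>0 < w \<Longrightarrow> \<bar>\<xi>\<bar> \<le> w \<Longrightarrow> norm (exp (of_real t * \<Psi> w \<xi>)) \<le> exp (- (C * (t * \<xi>\<^sup>2 * \<sigma> w)))"
    "\<And>t w \<xi>. 0 < t \<Longrightarrow> x\<^sub>0 < w \<Longrightarrow> w \<le> \<bar>\<xi>\<bar> \<Longrightarrow>
       norm (exp (of_real t * \<Psi> w \<xi>)) \<le> exp (- (C * (t * w\<^sup>2 * \<sigma> w) * (\<bar>\<xi>\<bar> / w) powr \<alpha>))"
    by (rule norm_exp_Psi_le) (rule that)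
  have "exp (- (C * (t * \<xi>\<^sup>2 * \<sigma> w))) \<le> 1" "exp (- (C * (t * w\<^sup>2 * \<sigma> w) * (\<bar>\<xi>\<bar> / w) powr \<alpha>)) \<le> 1"
    using C(1) assms sigma_nonneg[of w] by auto
  then show ?thesis using C(2,3)[OF assms, of \<xi>] by linarith
qed

lemma integrable_exp_Psi:
  assumes t: "0 < t" and w: "x\<^sub>0 < w"
  shows "integrable lborel (\<lambda>\<xi>. exp (of_real t * \<Psi> w \<xi>))"
proof -
  have w': "0 < w" using w x0_nonneg by simp
  obtain C where C: "0 < C"
    "\<And>t w \<xi>. 0 < t \<Longrightarrow> x\<^sub>0 < w \<Longrightarrow> w \<le> \<bar>\<xi>\<bar> \<Longrightarrow>
       norm (exp (of_real t * \<Psi> w \<xi>)) \<le> exp (- (C * (t * w\<^sup>2 * \<sigma> w) * (\<bar>\<xi>\<bar> / w) powr \<alpha>))"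
    using norm_exp_Psi_le by metis
  define C' where "C' = C * (t * w\<^sup>2 * \<sigma> w) / w powr \<alpha>"
  have "0 < C'" using C t w' sigma_pos'[OF w'] by (simp add: C'_def)
  have decay: "norm (exp (of_real t * \<Psi> w \<xi>)) \<le> exp (- (C' * \<bar>\<xi>\<bar> powr \<alpha>))" if "w \<le> \<bar>\<xi>\<bar>" for \<xi>
    using C(2)[OF t w that] w' by (simp add: C'_def powr_divide)
  obtain D where D: "\<And>y v. v \<le> 1 \<Longrightarrow> (w \<le> \<bar>y\<bar> \<Longrightarrow> v \<le> exp (- (C' * \<bar>y\<bar> powr \<alpha>))) \<Longrightarrow> v \<le> D / (1 + y\<^sup>2)"
    using stretched_exp_le[OF \<open>0 < C'\<close> alpha_pos, of w] by blast
  have "continuous_on UNIV (\<lambda>\<xi>. exp (of_real t * \<Psi> w \<xi>))"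
    by (intro continuous_intros continuous_Psi w')
  then have [measurable]: "(\<lambda>\<xi>. exp (of_real t * \<Psi> w \<xi>)) \<in> borel_measurable borel"
    by (rule borel_measurable_continuous_onI)
  have "norm (exp (of_real t * \<Psi> w \<xi>)) \<le> D / (1 + \<xi>\<^sup>2)" for \<xi>
    by (rule D[OF norm_exp_Psi_le_1[OF t w] decay])
  then have "norm (exp (of_real t * \<Psi> w \<xi>)) \<le> norm (D / (1 + \<xi>\<^sup>2))" for \<xi>
    by (metis real_norm_def abs_ge_self order.trans)
  then show ?thesis
    by (intro Bochner_Integration.integrable_bound[OF integrable_inverse_one_plus_square[of D]] AE_I2) simp_all
qed

text \<open>
  After the substitution \<open>\<xi> = u / \<surd>(t \<sigma> w)\<close> one has \<open>\<bar>\<xi>\<bar> / w = \<bar>u\<bar> / \<surd>m\<close> with \<open>m = t w\<^sup>2 \<sigma> w\<close>. For \<open>\<bar>\<xi>\<bar> \<ge> w\<close> the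
  exponent is thus at least a multiple of \<open>m\<^bsup>1 - \<alpha>/2\<^esup> \<bar>u\<bar>\<^sup>\<alpha>\<close>, hence of \<open>\<bar>u\<bar>\<^sup>\<alpha>\<close> since \<open>m \<ge> 1\<close> and \<open>\<alpha> \<le> 2\<close>. For
  \<open>\<bar>\<xi>\<bar> \<le> w\<close> it is at least a multiple of \<open>u\<^sup>2\<close>, which is at least \<open>\<bar>u\<bar>\<^sup>\<alpha>\<close> once \<open>\<bar>u\<bar> \<ge> 1\<close>. The majorant therefore
  does not depend on \<open>t\<close> and \<open>w\<close>.
\<close>

lemma rescaled_exp_Psi_le:
  obtains D where
    "\<And>t w u. 0 < t \<Longrightarrow> x\<^sub>0 < w \<Longrightarrow> 1 \<le> t * w\<^sup>2 * \<sigma> w \<Longrightarrow>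
       norm (exp (of_real t * \<Psi> w (u / sqrt (t * \<sigma> w)))) \<le> D / (1 + u\<^sup>2)"
proof -
  obtain C where C: "0 < C"
    "\<And>t w \<xi>. 0 < t \<Longrightarrow> x\<^sub>0 < w \<Longrightarrow> \<bar>\<xi>\<bar> \<le> w \<Longrightarrow> norm (exp (of_real t * \<Psi> w \<xi>)) \<le> exp (- (C * (t * \<xi>\<^sup>2 * \<sigma> w)))"
    "\<And>t w \<xi>. 0 < t \<Longrightarrow> x\<^sub>0 < w \<Longrightarrow> w \<le> \<bar>\<xi>\<bar> \<Longrightarrow>
       norm (exp (of_real t * \<Psi> w \<xi>)) \<le> exp (- (C * (t * w\<^sup>2 * \<sigma> w) * (\<bar>\<xi>\<bar> / w) powr \<alpha>))"
    by (rule norm_exp_Psi_le) (rule that)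
  obtain D where D: "\<And>y v. v \<le> 1 \<Longrightarrow> (1 \<le> \<bar>y\<bar> \<Longrightarrow> v \<le> exp (- (C * \<bar>y\<bar> powr \<alpha>))) \<Longrightarrow> v \<le> D / (1 + y\<^sup>2)"
    using stretched_exp_le[OF C(1) alpha_pos, of 1] by blast
  show thesis
  proof (rule that, rule D)
    fix t w u :: real assume t: "0 < t" and w: "x\<^sub>0 < w" and m: "1 \<le> t * w\<^sup>2 * \<sigma> w"
    have w': "0 < w" using w x0_nonneg by simp
    define s where "s = sqrt (t * \<sigma> w)"
    have s: "0 < s" "s\<^sup>2 = t * \<sigma> w" using t sigma_pos'[OF w'] by (auto simp: s_def)
    have ws: "(w * s)\<^sup>2 = t * w\<^sup>2 * \<sigma> w" by (simp add: power_mult_distrib s mult_ac)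
    have "1\<^sup>2 \<le> (w * s)\<^sup>2" using m unfolding ws by simp
    then have ws1: "1 \<le> w * s" by (rule power2_le_imp_le) (use w' s in simp)
    show "norm (exp (of_real t * \<Psi> w (u / sqrt (t * \<sigma> w)))) \<le> 1"
      by (rule norm_exp_Psi_le_1[OF t w])
    assume u: "1 \<le> \<bar>u\<bar>"
    show "norm (exp (of_real t * \<Psi> w (u / sqrt (t * \<sigma> w)))) \<le> exp (- (C * \<bar>u\<bar> powr \<alpha>))"
    proof (cases "\<bar>u / s\<bar> \<le> w")
      case True
      have "t * (u / s)\<^sup>2 * \<sigma> w = u\<^sup>2"
        using s t sigma_pos'[OF w'] by (simp add: power_divide)
      then have "norm (exp (of_real t * \<Psi> w (u / s))) \<le> exp (- (C * u\<^sup>2))"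
        using C(2)[OF t w True] by simp
      moreover have "\<bar>u\<bar> powr \<alpha> \<le> \<bar>u\<bar> powr 2" using u alpha_le by (intro powr_mono) auto
      then have "C * \<bar>u\<bar> powr \<alpha> \<le> C * u\<^sup>2"
        using u C(1) by (intro mult_left_mono) (auto simp: powr_numeral)
      ultimately show ?thesis unfolding s_def[symmetric] by (meson exp_le_cancel_iff neg_le_iff_le order.trans)
    next
      case False
      then have "norm (exp (of_real t * \<Psi> w (u / s))) \<le> exp (- (C * (t * w\<^sup>2 * \<sigma> w) * (\<bar>u / s\<bar> / w) powr \<alpha>))"
        using C(3)[OF t w, of "u / s"] by linarith
      also have "(\<bar>u / s\<bar> / w) powr \<alpha> = \<bar>u\<bar> powr \<alpha> / (w * s) powr \<alpha>"
        using s w' by (simp add: abs_div powr_divide mult.commute)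
      also have "C * (t * w\<^sup>2 * \<sigma> w) * (\<bar>u\<bar> powr \<alpha> / (w * s) powr \<alpha>) = C * \<bar>u\<bar> powr \<alpha> * ((w * s) powr 2 / (w * s) powr \<alpha>)"
        using ws ws1 by (simp add: powr_numeral)
      also have "exp (- (C * \<bar>u\<bar> powr \<alpha> * ((w * s) powr 2 / (w * s) powr \<alpha>))) \<le> exp (- (C * \<bar>u\<bar> powr \<alpha> * 1))"
      proof -
        have "(w * s) powr \<alpha> \<le> (w * s) powr 2" using ws1 alpha_le by (intro powr_mono) auto
        then have "1 \<le> (w * s) powr 2 / (w * s) powr \<alpha>" using ws1 s w' by (simp add: field_simps)
        then have "C * \<bar>u\<bar> powr \<alpha> * 1 \<le> C * \<bar>u\<bar> powr \<alpha> * ((w * s) powr 2 / (w * s) powr \<alpha>)"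
          using C(1) by (intro mult_left_mono) auto
        then show ?thesis by simp
      qed
      finally show ?thesis unfolding s_def[symmetric] by simp
    qed
  qed
qed

section \<open>The saddle point asymptotics\<close>

text \<open>
  If uniformity failed, there would be a sequence of pairs \<open>(t, w)\<close> with \<open>t w\<^sup>2 \<sigma> w\<close> tending to infinity and the
  error staying above \<open>\<epsilon>\<close>; dominated convergence along it contradicts this.
\<close>

lemma saddle_point_asymptotics:
  assumes "0 < \<epsilon>"
  shows "\<exists>M\<^sub>0>0. \<forall>t w. 0 < t \<longrightarrow> x\<^sub>0 < w \<longrightarrow> M\<^sub>0 < t * w\<^sup>2 * \<sigma> w \<longrightarrow>
     \<bar>1 / (2 * pi) * (\<integral>\<xi>. Re (exp (of_real t * \<Psi> w \<xi>)) \<partial>lborel) * sqrt (2 * pi * t * \<sigma> w) - 1\<bar> \<le> \<epsilon>"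
proof (rule ccontr)
  let ?m = "\<lambda>t w. t * w\<^sup>2 * \<sigma> w"
  let ?I = "\<lambda>t w. 1 / (2 * pi) * (\<integral>\<xi>. Re (exp (of_real t * \<Psi> w \<xi>)) \<partial>lborel) * sqrt (2 * pi * t * \<sigma> w)"
  assume "\<not> ?thesis"
  then have "\<forall>n::nat. \<exists>t w. 0 < t \<and> x\<^sub>0 < w \<and> real (Suc n) < ?m t w \<and> \<epsilon> < \<bar>?I t w - 1\<bar>"
    by (metis not_le of_nat_0_less_iff zero_less_Suc)
  then obtain t w :: "nat \<Rightarrow> real" where t: "\<And>n. 0 < t n" and w: "\<And>n. x\<^sub>0 < w n"
    and m: "\<And>n. real (Suc n) < ?m (t n) (w n)" and I: "\<And>n. \<epsilon> < \<bar>?I (t n) (w n) - 1\<bar>"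
    by metis
  have w': "0 < w n" for n using w[of n] x0_nonneg by simp
  define s where "s n = sqrt (t n * \<sigma> (w n))" for n
  have s: "0 < s n" "(s n)\<^sup>2 = t n * \<sigma> (w n)" for n
    using t[of n] sigma_pos'[OF w'[of n]] by (auto simp: s_def)
  have ws: "?m (t n) (w n) = (w n * s n)\<^sup>2" for n by (simp add: power_mult_distrib s mult_ac)
  have ws_lim: "filterlim (\<lambda>n. w n * s n) at_top sequentially"
  proof (rule filterlim_at_top_mono)
    show "filterlim (\<lambda>n. sqrt (real (Suc n))) at_top sequentially"
      by (intro filterlim_compose[OF sqrt_at_top] filterlim_compose[OF filterlim_real_sequentially] filterlim_Suc)
    show "\<forall>\<^sub>F n in sequentially. sqrt (real (Suc n)) \<le> w n * s n"
      using m unfolding ws by (intro always_eventually allI real_le_lsqrt) (auto simp: less_imp_le w' s(1))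
  qed
  obtain K where K: "0 < K" "\<And>w. x\<^sub>0 < w \<Longrightarrow> \<sigma> (w / 2) \<le> K * \<sigma> w"
    by (rule sigma_half_le) (rule that)
  obtain D where D:
    "\<And>t w u. 0 < t \<Longrightarrow> x\<^sub>0 < w \<Longrightarrow> 1 \<le> t * w\<^sup>2 * \<sigma> w \<Longrightarrow>
       norm (exp (of_real t * \<Psi> w (u / sqrt (t * \<sigma> w)))) \<le> D / (1 + u\<^sup>2)"
    by (rule rescaled_exp_Psi_le) (rule that)
  let ?E = "\<lambda>n u. exp (of_real (t n) * \<Psi> (w n) (u / s n))"
  have [measurable]: "?E n \<in> borel_measurable borel" for n
  proof -
    have "continuous_on UNIV (\<lambda>u. \<Psi> (w n) (u / s n))"
      by (rule continuous_on_compose2[OF continuous_Psi[OF w']]) (use s(1)[of n] in \<open>auto intro!: continuous_intros\<close>)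
    then show ?thesis
      by (intro borel_measurable_continuous_onI continuous_intros)
  qed
  have pointwise: "(\<lambda>n. ?E n u) \<longlonglongrightarrow> exp (of_real (- (u\<^sup>2 / 2)))" for u
  proof (rule tendsto_exp)
    have bound: "norm (of_real (t n) * \<Psi> (w n) (u / s n) - of_real (- (u\<^sup>2 / 2))) \<le> K * \<bar>u\<bar> ^ 3 / 3 / (w n * s n)" for n
    proof -
      have "of_real (t n) * \<Psi> (w n) (u / s n) - of_real (- (u\<^sup>2 / 2)) =
          of_real (t n) * (\<Psi> (w n) (u / s n) + of_real ((u / s n)\<^sup>2 / 2 * \<sigma> (w n)))"
      proof -
        have "t n * ((u / s n)\<^sup>2 / 2 * \<sigma> (w n)) = u\<^sup>2 / 2"
          using s[of n] t[of n] sigma_pos'[OF w'[of n]] by (simp add: power_divide)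
        then show ?thesis
          by (metis (no_types) add_diff_cancel diff_minus_eq_add distrib_left of_real_minus of_real_mult)
      qed
      then have "norm (of_real (t n) * \<Psi> (w n) (u / s n) - of_real (- (u\<^sup>2 / 2))) =
          t n * norm (\<Psi> (w n) (u / s n) + of_real ((u / s n)\<^sup>2 / 2 * \<sigma> (w n)))"
        using t[of n] by (simp only: norm_mult norm_of_real abs_of_pos)
      also have "\<dots> \<le> t n * (\<bar>u / s n\<bar> ^ 3 / (3 * w n) * \<sigma> (w n / 2))"
        using t[of n] by (intro mult_left_mono Psi_approx w') simp
      also have "\<dots> \<le> t n * (\<bar>u / s n\<bar> ^ 3 / (3 * w n) * (K * \<sigma> (w n)))"
        using K(2)[OF w[of n]] t[of n] w'[of n] by (intro mult_left_mono) auto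
      also have "\<dots> = K * \<bar>u\<bar> ^ 3 / 3 * (t n * \<sigma> (w n)) / (w n * s n ^ 3)"
        using s(1)[of n] w'[of n] by (simp add: abs_div power_divide field_simps)
      also have "\<dots> = K * \<bar>u\<bar> ^ 3 / 3 / (w n * s n)"
        unfolding s(2)[symmetric] using s(1)[of n] w'[of n] by (simp add: power2_eq_square power3_eq_cube)
      finally show ?thesis .
    qed
    have "(\<lambda>n. K * \<bar>u\<bar> ^ 3 / 3 / (w n * s n)) \<longlonglongrightarrow> 0"
      by (rule tendsto_divide_0[OF tendsto_const]) (rule filterlim_at_top_imp_at_infinity[OF ws_lim])
    then have "(\<lambda>n. of_real (t n) * \<Psi> (w n) (u / s n) - of_real (- (u\<^sup>2 / 2))) \<longlonglongrightarrow> 0"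
      by (rule Lim_null_comparison[rotated]) (use bound in auto)
    then show "(\<lambda>n. of_real (t n) * \<Psi> (w n) (u / s n)) \<longlonglongrightarrow> of_real (- (u\<^sup>2 / 2))"
      by (rule LIM_zero_cancel)
  qed
  have "(\<lambda>n. \<integral>u. Re (?E n u) \<partial>lborel) \<longlonglongrightarrow> (\<integral>u. Re (exp (of_real (- (u\<^sup>2 / 2)))) \<partial>lborel)"
  proof (rule integral_dominated_convergence[where w = "\<lambda>u. D / (1 + u\<^sup>2)"])
    show "integrable lborel (\<lambda>u. D / (1 + u\<^sup>2))" by (rule integrable_inverse_one_plus_square)
    show "AE u in lborel. (\<lambda>n. Re (?E n u)) \<longlonglongrightarrow> Re (exp (of_real (- (u\<^sup>2 / 2))))"
      by (intro AE_I2 tendsto_Re pointwise)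
    have "norm (Re (?E n u)) \<le> D / (1 + u\<^sup>2)" for n u
    proof -
      have "1 \<le> ?m (t n) (w n)" using m[of n] by simp
      then show ?thesis
        using abs_Re_le_cmod[of "?E n u"] D[OF t[of n] w[of n], of u] by (simp add: s_def)
    qed
    then show "AE u in lborel. norm (Re (?E n u)) \<le> D / (1 + u\<^sup>2)" for n by blast
  qed measurable
  also have "(\<integral>u. Re (exp (of_real (- (u\<^sup>2 / 2)))) \<partial>lborel) = sqrt (2 * pi)"
  proof -
    have "(\<integral>u. Re (exp (of_real (- (u\<^sup>2 / 2)))) \<partial>lborel) = (\<integral>u. sqrt (2 * pi) * std_normal_density u \<partial>lborel)"
      by (intro Bochner_Integration.integral_cong refl) (simp add: std_normal_density_def exp_of_real flip: of_real_minus of_real_divide)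
    then show ?thesis by simp
  qed
  finally have lim: "(\<lambda>n. \<integral>u. Re (?E n u) \<partial>lborel) \<longlonglongrightarrow> sqrt (2 * pi)" .
  have I_eq: "?I (t n) (w n) = sqrt (2 * pi) / (2 * pi) * (\<integral>u. Re (?E n u) \<partial>lborel)" for n
  proof -
    have "(\<integral>\<xi>. Re (exp (of_real (t n) * \<Psi> (w n) \<xi>)) \<partial>lborel) = \<bar>1 / s n\<bar> *\<^sub>R (\<integral>u. Re (exp (of_real (t n) * \<Psi> (w n) (0 + 1 / s n * u))) \<partial>lborel)"
      using s(1)[of n] by (intro lborel_integral_real_affine) simp
    also have "\<dots> = 1 / s n * (\<integral>u. Re (?E n u) \<partial>lborel)"
      using s(1)[of n] by simp
    finally have "(\<integral>\<xi>. Re (exp (of_real (t n) * \<Psi> (w n) \<xi>)) \<partial>lborel) = 1 / s n * (\<integral>u. Re (?E n u) \<partial>lborel)" .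
    moreover have "sqrt (2 * pi * t n * \<sigma> (w n)) = sqrt (2 * pi) * s n"
      by (simp add: s_def real_sqrt_mult)
    ultimately show ?thesis using s(1)[of n] by simp
  qed
  have "(\<lambda>n. ?I (t n) (w n)) \<longlonglongrightarrow> sqrt (2 * pi) / (2 * pi) * sqrt (2 * pi)"
    unfolding I_eq by (intro tendsto_intros lim)
  also have "sqrt (2 * pi) / (2 * pi) * sqrt (2 * pi) = 1" by simp
  finally have "(\<lambda>n. \<bar>?I (t n) (w n) - 1\<bar>) \<longlonglongrightarrow> \<bar>1 - 1\<bar>"
    by (intro tendsto_intros)
  then have "\<forall>\<^sub>F n in sequentially. \<bar>?I (t n) (w n) - 1\<bar> < \<epsilon>"
    using assms by (intro order_tendstoD(2)) auto
  then show False
    using I by (auto simp: eventually_sequentially dest: less_asym)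
qed

end

theorem theorem3p3:
  fixes M :: "'a measure" and T :: "real \<Rightarrow> 'a \<Rightarrow> real"
    and \<phi> :: "real \<Rightarrow> real" and b :: real and \<nu> :: "real measure"
    and \<alpha> c x\<^sub>0 :: real
  assumes "subordinator M T"
    and "laplace_exponent M T \<phi>"
    and "levy_khintchine b \<nu> \<phi>"
    and "\<exists>x>0. deriv (deriv \<phi>) x \<noteq> 0"
    and "0 < c" and "c \<le> 1" and "x\<^sub>0 \<ge> 0" and "\<alpha> > 0"
    and "(\<lambda>x. - deriv (deriv \<phi>) x) \<in> WLSC (\<alpha> - 2) c x\<^sub>0"
  shows "(\<forall>t>0. absolutely_continuous lborel (distr M borel (T t))) \<and>
    (\<exists>p :: real \<Rightarrow> real \<Rightarrow> real.
       (\<forall>t>0. continuous_density M (T t) (p t)) \<and>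
       (\<forall>\<epsilon>>0. \<exists>M\<^sub>0>0. \<forall>t w. t > 0 \<longrightarrow> w > x\<^sub>0 \<longrightarrow> t * w\<^sup>2 * (- deriv (deriv \<phi>) w) > M\<^sub>0 \<longrightarrow>
          \<bar>p t (t * deriv \<phi> w) * sqrt (2 * pi * t * (- deriv (deriv \<phi>) w))
             * exp (t * (\<phi> w - w * deriv \<phi> w)) - 1\<bar> \<le> \<epsilon>))"
proof -
  interpret S: subordinator M T by fact
  interpret levy_triplet b \<nu> \<phi> by unfold_locales fact
  note x0 = \<open>x\<^sub>0 \<ge> 0\<close>
  interpret L: scaled_levy_triplet b \<nu> \<phi> c x\<^sub>0 "min \<alpha> 2"
  proof unfold_locales
    show "c * l powr (min \<alpha> 2 - 2) * \<sigma> x \<le> \<sigma> (l * x)" if l: "1 \<le> l" and x: "x\<^sub>0 < x" for l x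
    proof -
      have pos: "0 < x" "0 < l * x" using x x0 l by auto
      have "c * l powr (min \<alpha> 2 - 2) * \<sigma> x \<le> c * l powr (\<alpha> - 2) * \<sigma> x"
        using l \<open>0 < c\<close> sigma_nonneg by (intro mult_right_mono mult_left_mono powr_mono) auto
      also have "\<dots> \<le> \<sigma> (l * x)"
      proof -
        have "c * l powr (\<alpha> - 2) * (- deriv (deriv \<phi>) x) \<le> - deriv (deriv \<phi>) (l * x)"
          using assms(9) l x unfolding WLSC_def by blast
        then show ?thesis using pos by (simp add: deriv2_exponent)
      qed
      finally show ?thesis .
    qed
    obtain y where y: "0 < y" "deriv (deriv \<phi>) y \<noteq> 0" using assms(4) by blast
    show "0 < \<sigma> x" if "0 < x" for x
      using y that by (intro sigma_pos[of y]) (auto simp: deriv2_exponent)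
  qed (use assms in auto)
  have law: "real_distribution (distr M borel (T t))" "AE x in distr M borel (T t). 0 \<le> x"
    "\<And>u. 0 < u \<Longrightarrow> (\<integral>x. exp (- (u * x)) \<partial>distr M borel (T t)) = exp (- (t * \<phi> u))" if t: "0 < t" for t
  proof -
    have [measurable]: "T t \<in> borel_measurable M" using S.random_variable_T[of t] t by simp
    show "real_distribution (distr M borel (T t))" by (rule S.real_distribution_distr) measurable
    have "AE \<omega> in M. 0 \<le> T t \<omega>"
      using S.start_zero S.nondecreasing_paths
    proof eventually_elim
      case (elim \<omega>)
      then show ?case using mono_onD[OF elim(2), of 0 t] t by simp
    qed
    then show "AE x in distr M borel (T t). 0 \<le> x" by (subst AE_distr_iff) auto
    show "(\<integral>x. exp (- (u * x)) \<partial>distr M borel (T t)) = exp (- (t * \<phi> u))" if "0 < u" for u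
      using assms(2) t that by (subst integral_distr) (auto simp: laplace_exponent_def)
  qed
  have ex: "\<exists>q. continuous_on UNIV q \<and> (\<forall>x. 0 \<le> q x) \<and> distr M borel (T t) = density lborel (\<lambda>x. ennreal (q x)) \<and>
     q (t * deriv \<phi> w) * exp (t * (\<phi> w - w * deriv \<phi> w)) =
       1 / (2 * pi) * (\<integral>\<xi>. Re (exp (of_real t * \<Psi> w \<xi>)) \<partial>lborel)" if "0 < t" "x\<^sub>0 < w" for t w
    using that x0 by (intro tilted_density law L.integrable_exp_Psi) auto
  \<comment> \<open>The densities obtained for different \<open>w\<close> are continuous densities of the same law, so they
      coincide and any choice of \<open>p t\<close> satisfies the saddle point identity for every \<open>w\<close>.\<close>
  define p where "p t = (SOME q. continuous_on UNIV q \<and> (\<forall>x. 0 \<le> q x) \<and>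
      distr M borel (T t) = density lborel (\<lambda>x. ennreal (q x)))" for t
  have p: "continuous_on UNIV (p t)" "\<And>x. 0 \<le> p t x" "distr M borel (T t) = density lborel (\<lambda>x. ennreal (p t x))"
    if t: "0 < t" for t
  proof -
    have "\<exists>q. continuous_on UNIV q \<and> (\<forall>x. 0 \<le> q x) \<and> distr M borel (T t) = density lborel (\<lambda>x. ennreal (q x))"
      using ex[OF t, of "x\<^sub>0 + 1"] by auto
    from someI_ex[OF this] show "continuous_on UNIV (p t)" "\<And>x. 0 \<le> p t x"
      "distr M borel (T t) = density lborel (\<lambda>x. ennreal (p t x))" by (auto simp: p_def)
  qed
  have p_saddle: "p t (t * deriv \<phi> w) * exp (t * (\<phi> w - w * deriv \<phi> w)) =
      1 / (2 * pi) * (\<integral>\<xi>. Re (exp (of_real t * \<Psi> w \<xi>)) \<partial>lborel)" if t: "0 < t" and w: "x\<^sub>0 < w" for t w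
  proof -
    obtain q where q: "continuous_on UNIV q" "\<And>x. 0 \<le> q x" "distr M borel (T t) = density lborel (\<lambda>x. ennreal (q x))"
      and eq: "q (t * deriv \<phi> w) * exp (t * (\<phi> w - w * deriv \<phi> w)) =
       1 / (2 * pi) * (\<integral>\<xi>. Re (exp (of_real t * \<Psi> w \<xi>)) \<partial>lborel)"
      using ex[OF t w] by auto
    have "p t = q"
      using p[OF t] q by (intro continuous_nonneg_density_unique) auto
    then show ?thesis using eq by simp
  qed
  have dens: "continuous_density M (T t) (p t)" if t: "0 < t" for t
    unfolding continuous_density_def distributed_def
    using p[OF t] S.random_variable_T[of t] t distr_cong[of M M lborel borel "T t" "T t"]
    by (auto intro!: borel_measurable_continuous_onI measurable_compose[OF borel_measurable_continuous_onI])
  show ?thesis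
  proof (intro conjI exI[of _ p] allI impI)
    fix t :: real assume t: "0 < t"
    have "(\<lambda>x. ennreal (p t x)) \<in> borel_measurable lborel"
      using borel_measurable_continuous_onI[OF p(1)[OF t]] by measurable
    then show "absolutely_continuous lborel (distr M borel (T t))"
      unfolding p(3)[OF t] by (rule absolutely_continuousI_density)
    show "continuous_density M (T t) (p t)" by (rule dens[OF t])
  next
    fix \<epsilon> :: real assume "0 < \<epsilon>"
    from L.saddle_point_asymptotics[OF this] obtain M\<^sub>0 where "0 < M\<^sub>0" and M0: "\<And>t w. 0 < t \<Longrightarrow> x\<^sub>0 < w \<Longrightarrow> M\<^sub>0 < t * w\<^sup>2 * \<sigma> w \<Longrightarrow>
     \<bar>1 / (2 * pi) * (\<integral>\<xi>. Re (exp (of_real t * \<Psi> w \<xi>)) \<partial>lborel) * sqrt (2 * pi * t * \<sigma> w) - 1\<bar> \<le> \<epsilon>"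
      by blast
    show "\<exists>M\<^sub>0>0. \<forall>t w. t > 0 \<longrightarrow> w > x\<^sub>0 \<longrightarrow> t * w\<^sup>2 * (- deriv (deriv \<phi>) w) > M\<^sub>0 \<longrightarrow>
          \<bar>p t (t * deriv \<phi> w) * sqrt (2 * pi * t * (- deriv (deriv \<phi>) w))
             * exp (t * (\<phi> w - w * deriv \<phi> w)) - 1\<bar> \<le> \<epsilon>"
    proof (intro exI[of _ M\<^sub>0] conjI allI impI)
      show "0 < M\<^sub>0" by fact
      fix t w assume tw: "0 < t" "x\<^sub>0 < w" and m: "M\<^sub>0 < t * w\<^sup>2 * (- deriv (deriv \<phi>) w)"
      have sig: "- deriv (deriv \<phi>) w = \<sigma> w" using tw x0 by (simp add: deriv2_exponent)
      have "p t (t * deriv \<phi> w) * sqrt (2 * pi * t * \<sigma> w) * exp (t * (\<phi> w - w * deriv \<phi> w)) =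
          1 / (2 * pi) * (\<integral>\<xi>. Re (exp (of_real t * \<Psi> w \<xi>)) \<partial>lborel) * sqrt (2 * pi * t * \<sigma> w)"
        unfolding p_saddle[OF tw, symmetric] by simp
      then show "\<bar>p t (t * deriv \<phi> w) * sqrt (2 * pi * t * (- deriv (deriv \<phi>) w))
             * exp (t * (\<phi> w - w * deriv \<phi> w)) - 1\<bar> \<le> \<epsilon>"
        using M0[OF tw] m unfolding sig by simp
    qed
  qed
qed

end
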